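(* Let $\mathcal{H}$ be a complex separable Hilbert space, let $\mathcal{A}\subseteq\mathscr{B}(\mathcal{H})$ be a von Neumann algebra and let $\tau:\mathcal{A}\to\mathcal{A}$ be a normal contractive completely positive map. Let $(\mathcal{K},\mathcal{B},\theta)$ be the minimal dilation of $(\mathcal{H},\mathcal{A},\tau)$ and let $p$ be the orthogonal projection of $\mathcal{K}$ onto $\mathcal{H}$. Then the compression map $z\mapsto pzp$ from $\mathcal{B}$ to $\mathcal{A}$, restricted to $\mathcal{P}(\theta)$, is a complete isometric isomorphism (a completely isometric linear bijection) from $\mathcal{P}(\theta)$ onto $\mathcal{P}(\tau)$.
   Context: Peripheral spaces. For a normal contractive completely positive map $\sigma$ on a von Neumann algebra $\mathcal{M}$ and $\lambda\in\mathbb{T}=\{z\in\mathbb{C}:|z|=1\}$, put $E_\lambda(\sigma)=\{x\in\mathcal{M}:\sigma(x)=\lambda x\}$, let $E(\sigma)$ be the linear span of $\bigcup_{\lambda\in\mathbb{T}}E_\lambda(\sigma)$, and let $\mathcal{P}(\sigma)$ be the norm closure of $E(\sigma)$. Minimal dilation. For a Hilbert space $\mathcal{K}\supseteq\mathcal{H}$ with projection $p$ onto $\mathcal{H}$, operators $x\in\mathscr{B}(\mathcal{H})$ are identified with $pxp\in\mathscr{B}(\mathcal{K})$ (extended by $0$ on $\mathcal{H}^\perp$). The minimal dilation of $(\mathcal{H},\mathcal{A},\tau)$, known to exist and to be unique up to unitary equivalence, is a triple $(\mathcal{K},\mathcal{B},\theta)$ such that: (i) $\mathcal{K}\supseteq\mathcal{H}$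 is a Hilbert space; (ii) $\mathcal{B}\subseteq\mathscr{B}(\mathcal{K})$ is a von Neumann algebra with $\mathcal{A}=p\mathcal{B}p$; (iii) $\theta:\mathcal{B}\to\mathcal{B}$ is a normal $*$-endomorphism (not necessarily unital); (iv) $\tau^n(x)=p\theta^n(x)p$ for all $x\in\mathcal{A}$, $n\in\mathbb{Z}_+$; (v) $\mathcal{K}=\overline{\mathrm{span}}\{\theta^n(x_n)\theta^{n-1}(x_{n-1})\cdots\theta(x_1)h: h\in\mathcal{H},\ x_1,\dots,x_n\in\mathcal{A},\ n\ge 0\}$; (vi) $\mathcal{B}$ is the von Neumann algebra generated by $\{\theta^n(x):n\in\mathbb{Z}_+,x\in\mathcal{A}\}$. When $\tau(1)\neq 1$ the minimal dilation is the one obtained by unitization: put $\tilde{\mathcal{H}}=\mathcal{H}\oplus\mathbb{C}$, $\tilde{\mathcal{A}}=\mathcal{A}\oplus\mathbb{C}$ and $\tilde\tau(x\oplus c)=[\tau(x)+c(1-\tau(1))]\oplus c$, a normal unital completely positive map; let $(\tilde{\mathcal{K}},\tilde{\mathcal{B}},\tilde\theta)$ be the minimal dilation of $(\tilde{\mathcal{H}},\tilde{\mathcal{A}},\tilde\tau)$ and $\mathcal{K}=(0\oplus\mathbb{C})^\perp\subseteq\tilde{\mathcal{K}}$; then $\tilde{\mathcal{B}}=\mathcal{B}\oplus\mathbb{C}$ and $\tilde\theta(b\oplus c)=[\theta(b)+c(1-\theta(1))]\oplus c$, and this defines $\mathcal{B}$ and $\theta$. *)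

theory Defs
  imports "HOL-Analysis.Analysis"
begin

section \<open>Complex Hilbert spaces\<close>

class complex_normed_vector = real_normed_vector +
  fixes scaleC :: "complex \<Rightarrow> 'a \<Rightarrow> 'a"  (infixr \<open>*\<^sub>C\<close> 75)
  assumes scaleC_add_right: "a *\<^sub>C (x + y) = a *\<^sub>C x + a *\<^sub>C y"
    and scaleC_add_left: "(a + b) *\<^sub>C x = a *\<^sub>C x + b *\<^sub>C x"
    and scaleC_scaleC: "a *\<^sub>C (b *\<^sub>C x) = (a * b) *\<^sub>C x"
    and scaleR_scaleC: "r *\<^sub>R x = complex_of_real r *\<^sub>C x"
    and norm_scaleC: "norm (a *\<^sub>C x) = cmod a * norm x"

lemma vector_space_scaleC: "vector_space (scaleC :: complex \<Rightarrow> 'a::complex_normed_vector \<Rightarrow> 'a)"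
proof
  fix x :: 'a
  show "1 *\<^sub>C x = x"
    using scaleR_scaleC[of 1 x] by simp
qed (simp_all add: scaleC_add_right scaleC_add_left scaleC_scaleC)

interpretation complex_vector: vector_space "scaleC :: complex \<Rightarrow> 'a::complex_normed_vector \<Rightarrow> 'a"
  by (rule vector_space_scaleC)

abbreviation cspan :: "'a::complex_normed_vector set \<Rightarrow> 'a set"
  where "cspan \<equiv> complex_vector.span"

text \<open>The inner product is linear in the second argument. Positive definiteness, and the fact that
  the norm comes from the inner product, are inherited from \<^class>\<open>real_inner\<close>
  through \<open>inner_eq_Re_cinner\<close>.\<close>

class complex_hilbert_space = complex_normed_vector + real_inner + complete_space +
  fixes cinner :: "'a \<Rightarrow> 'a \<Rightarrow> complex"
  assumes cinner_commute: "cinner x y = cnj (cinner y x)"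
    and cinner_add_right: "cinner x (y + z) = cinner x y + cinner x z"
    and cinner_scaleC_right: "cinner x (c *\<^sub>C y) = c * cinner x y"
    and inner_eq_Re_cinner: "inner x y = Re (cinner x y)"

instantiation complex :: complex_hilbert_space
begin

definition scaleC_complex :: "complex \<Rightarrow> complex \<Rightarrow> complex"
  where "scaleC_complex = (*)"

definition cinner_complex :: "complex \<Rightarrow> complex \<Rightarrow> complex"
  where "cinner_complex x y = cnj x * y"

instance
  by standard
    (simp_all add: scaleC_complex_def cinner_complex_def algebra_simps scaleR_conv_of_real
      norm_mult inner_complex_def)

end

instantiation prod :: (complex_normed_vector, complex_normed_vector) complex_normed_vector
begin

definition scaleC_prod :: "complex \<Rightarrow> 'a \<times> 'b \<Rightarrow> 'a \<times> 'b"
  where "scaleC_prod c x = (c *\<^sub>C fst x, c *\<^sub>C snd x)"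

instance
proof
  fix a :: complex and x :: "'a \<times> 'b"
  have "norm (a *\<^sub>C x) = sqrt ((cmod a)\<^sup>2 * ((norm (fst x))\<^sup>2 + (norm (snd x))\<^sup>2))"
    by (simp add: scaleC_prod_def norm_prod_def norm_scaleC power_mult_distrib algebra_simps)
  then show "norm (a *\<^sub>C x) = cmod a * norm x"
    by (simp add: norm_prod_def real_sqrt_mult)
qed (simp_all add: scaleC_prod_def scaleC_add_right scaleC_add_left scaleC_scaleC scaleR_scaleC
      prod_eq_iff)

end

instantiation prod :: (complex_hilbert_space, complex_hilbert_space) complex_hilbert_space
begin

definition cinner_prod :: "'a \<times> 'b \<Rightarrow> 'a \<times> 'b \<Rightarrow> complex"
  where "cinner_prod x y = cinner (fst x) (fst y) + cinner (snd x) (snd y)"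

instance
proof
  fix x y :: "'a \<times> 'b"
  show "cinner x y = cnj (cinner y x)"
    by (simp add: cinner_prod_def cinner_commute[of "fst x"] cinner_commute[of "snd x"])
qed (simp_all add: cinner_prod_def scaleC_prod_def cinner_add_right cinner_scaleC_right
      inner_eq_Re_cinner inner_prod_def algebra_simps)

end


section \<open>Bounded operators\<close>

text \<open>Bounded operators are taken from the library type of bounded real-linear maps;
  \<open>clinear_ops\<close> singles out the complex-linear ones, i.e. $\mathscr{B}(H_1,H_2)$.\<close>

instantiation blinfun :: (real_normed_vector, complex_normed_vector) complex_normed_vector
begin

lift_definition scaleC_blinfun :: "complex \<Rightarrow> 'a \<Rightarrow>\<^sub>L 'b \<Rightarrow> 'a \<Rightarrow>\<^sub>L 'b"
  is "\<lambda>c f x. c *\<^sub>C f x"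
proof -
  fix c :: complex and f :: "'a \<Rightarrow> 'b"
  assume f: "bounded_linear f"
  then obtain K where K: "\<And>x. norm (f x) \<le> norm x * K"
    using bounded_linear.bounded by blast
  show "bounded_linear (\<lambda>x. c *\<^sub>C f x)"
  proof (rule bounded_linear_intro[where K = "cmod c * K"])
    fix x y r
    show "c *\<^sub>C f (x + y) = c *\<^sub>C f x + c *\<^sub>C f y"
      by (simp add: linear_add[OF bounded_linear.linear[OF f]] scaleC_add_right)
    show "c *\<^sub>C f (r *\<^sub>R x) = r *\<^sub>R (c *\<^sub>C f x)"
      by (simp add: linear_scale[OF bounded_linear.linear[OF f]] scaleR_scaleC scaleC_scaleC
          mult.commute)
    show "norm (c *\<^sub>C f x) \<le> norm x * (cmod c * K)"
      using mult_left_mono[OF K, of "cmod c" x] by (simp add: norm_scaleC algebra_simps)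
  qed
qed

instance
proof
  fix a :: complex and T :: "'a \<Rightarrow>\<^sub>L 'b"
  have le: "norm (c *\<^sub>C S) \<le> cmod c * norm S" for c :: complex and S :: "'a \<Rightarrow>\<^sub>L 'b"
  proof (rule norm_blinfun_bound)
    fix x
    show "norm (blinfun_apply (c *\<^sub>C S) x) \<le> cmod c * norm S * norm x"
      using mult_left_mono[OF norm_blinfun[of S x], of "cmod c"]
      by (simp add: scaleC_blinfun.rep_eq norm_scaleC algebra_simps)
  qed simp
  show "norm (a *\<^sub>C T) = cmod a * norm T"
  proof (cases "a = 0")
    case True
    then show ?thesis using le[of 0 T] by simp
  next
    case False
    have "T = inverse a *\<^sub>C (a *\<^sub>C T)"
      by (rule blinfun_eqI)
        (simp add: scaleC_blinfun.rep_eq scaleC_scaleC False)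
    then have "norm T \<le> cmod (inverse a) * norm (a *\<^sub>C T)"
      using le by metis
    then have "cmod a * norm T \<le> norm (a *\<^sub>C T)"
      using False by (simp add: norm_divide norm_inverse field_simps)
    with le[of a T] show ?thesis by simp
  qed
qed (rule blinfun_eqI; simp add: scaleC_blinfun.rep_eq blinfun.add_left blinfun.scaleR_left
      scaleC_add_right scaleC_add_left scaleC_scaleC scaleR_scaleC)+

end

definition clinear_ops :: "('a::complex_normed_vector \<Rightarrow>\<^sub>L 'b::complex_normed_vector) set"
  where "clinear_ops = {T. \<forall>c x. blinfun_apply T (c *\<^sub>C x) = c *\<^sub>C blinfun_apply T x}"

text \<open>The adjoint of a complex-linear operator exists by the Riesz representation theorem and
  is unique, so the description below is proper on \<open>clinear_ops\<close>.\<close>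

definition adj :: "('a::complex_hilbert_space \<Rightarrow>\<^sub>L 'b::complex_hilbert_space) \<Rightarrow> 'b \<Rightarrow>\<^sub>L 'a"
  where "adj T = (THE S. \<forall>x y. cinner (blinfun_apply S y) x = cinner y (T x))"

text \<open>The operator $[z_{ij}]$ on $H^n$ acts by $(x_j)_j \mapsto (\sum_j z_{ij} x_j)_i$; since \<open>n\<close>
  varies inside definitions, $H^n$ is represented by functions restricted to indices \<open>< n\<close>.
  The first definition is the operator norm, the second positivity on $H^n$.\<close>

definition matrix_norm ::
    "nat \<Rightarrow> (nat \<Rightarrow> nat \<Rightarrow> 'a::complex_hilbert_space \<Rightarrow>\<^sub>L 'b::complex_hilbert_space) \<Rightarrow> real"
  where "matrix_norm n z =
    (SUP x \<in> {x. (\<Sum>j<n. (norm (x j))\<^sup>2) \<le> 1}. sqrt (\<Sum>i<n. (norm (\<Sum>j<n. z i j (x j)))\<^sup>2))"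

definition matrix_positive ::
    "nat \<Rightarrow> (nat \<Rightarrow> nat \<Rightarrow> 'a::complex_hilbert_space \<Rightarrow>\<^sub>L 'a) \<Rightarrow> bool"
  where "matrix_positive n a \<longleftrightarrow>
    (\<forall>x. (\<Sum>i<n. cinner (x i) (\<Sum>j<n. a i j (x j))) \<in> \<real>\<^sub>\<ge>\<^sub>0)"


section \<open>Von Neumann algebras and maps between them\<close>

definition von_neumann_algebra :: "('a::complex_hilbert_space \<Rightarrow>\<^sub>L 'a) set \<Rightarrow> bool"
  where "von_neumann_algebra M \<longleftrightarrow>
    M \<subseteq> clinear_ops \<and> id_blinfun \<in> M \<and>
    (\<forall>S\<in>M. \<forall>T\<in>M. S + T \<in> M \<and> S o\<^sub>L T \<in> M) \<and>
    (\<forall>c. \<forall>T\<in>M. c *\<^sub>C T \<in> M) \<and>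
    (\<forall>T\<in>M. adj T \<in> M) \<and>
    closedin strong_operator_topology M"

definition generated_von_neumann_algebra ::
    "('a::complex_hilbert_space \<Rightarrow>\<^sub>L 'a) set \<Rightarrow> ('a \<Rightarrow>\<^sub>L 'a) set"
  where "generated_von_neumann_algebra S = \<Inter>{M. von_neumann_algebra M \<and> S \<subseteq> M}"

definition ultraweak_topology :: "('a::complex_hilbert_space \<Rightarrow>\<^sub>L 'a) topology"
  where "ultraweak_topology = topology_generated_by
    {(\<lambda>T. \<Sum>k. cinner (x k) (blinfun_apply T (y k))) -` U | (x :: nat \<Rightarrow> 'a) y U.
       summable (\<lambda>k. (norm (x k))\<^sup>2) \<and> summable (\<lambda>k. (norm (y k))\<^sup>2) \<and> open U}"

text \<open>Maps on an algebra \<open>M\<close> are represented by total functions on operators; only their values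
  on \<open>M\<close> matter.\<close>

definition normal_map_on :: "('a::complex_hilbert_space \<Rightarrow>\<^sub>L 'a) set \<Rightarrow> (('a \<Rightarrow>\<^sub>L 'a) \<Rightarrow> ('a \<Rightarrow>\<^sub>L 'a)) \<Rightarrow> bool"
  where "normal_map_on M \<sigma> \<longleftrightarrow>
    continuous_map (subtopology ultraweak_topology M) (subtopology ultraweak_topology M) \<sigma>"

definition clinear_map_on :: "'a::complex_normed_vector set \<Rightarrow> ('a \<Rightarrow> 'b::complex_normed_vector) \<Rightarrow> bool"
  where "clinear_map_on M \<sigma> \<longleftrightarrow>
    (\<forall>x\<in>M. \<forall>y\<in>M. \<sigma> (x + y) = \<sigma> x + \<sigma> y) \<and> (\<forall>c. \<forall>x\<in>M. \<sigma> (c *\<^sub>C x) = c *\<^sub>C \<sigma> x)"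

definition completely_positive_on ::
    "('a::complex_hilbert_space \<Rightarrow>\<^sub>L 'a) set \<Rightarrow> (('a \<Rightarrow>\<^sub>L 'a) \<Rightarrow> ('a \<Rightarrow>\<^sub>L 'a)) \<Rightarrow> bool"
  where "completely_positive_on M \<sigma> \<longleftrightarrow>
    (\<forall>n a. (\<forall>i<n. \<forall>j<n. a i j \<in> M) \<and> matrix_positive n a \<longrightarrow>
       matrix_positive n (\<lambda>i j. \<sigma> (a i j)))"

definition normal_contractive_cp_map ::
    "('a::complex_hilbert_space \<Rightarrow>\<^sub>L 'a) set \<Rightarrow> (('a \<Rightarrow>\<^sub>L 'a) \<Rightarrow> ('a \<Rightarrow>\<^sub>L 'a)) \<Rightarrow> bool"
  where "normal_contractive_cp_map M \<sigma> \<longleftrightarrow>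
    \<sigma> \<in> M \<rightarrow> M \<and> clinear_map_on M \<sigma> \<and> normal_map_on M \<sigma> \<and>
    completely_positive_on M \<sigma> \<and> (\<forall>x\<in>M. norm (\<sigma> x) \<le> norm x)"

definition normal_star_endomorphism ::
    "('a::complex_hilbert_space \<Rightarrow>\<^sub>L 'a) set \<Rightarrow> (('a \<Rightarrow>\<^sub>L 'a) \<Rightarrow> ('a \<Rightarrow>\<^sub>L 'a)) \<Rightarrow> bool"
  where "normal_star_endomorphism M \<theta> \<longleftrightarrow>
    \<theta> \<in> M \<rightarrow> M \<and> clinear_map_on M \<theta> \<and> normal_map_on M \<theta> \<and>
    (\<forall>x\<in>M. \<forall>y\<in>M. \<theta> (x o\<^sub>L y) = \<theta> x o\<^sub>L \<theta> y) \<and> (\<forall>x\<in>M. \<theta> (adj x) = adj (\<theta> x))"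


section \<open>Peripheral spaces\<close>

definition peripheral_eigenspace ::
    "('a::complex_hilbert_space \<Rightarrow>\<^sub>L 'a) set \<Rightarrow> (('a \<Rightarrow>\<^sub>L 'a) \<Rightarrow> ('a \<Rightarrow>\<^sub>L 'a)) \<Rightarrow> complex \<Rightarrow> ('a \<Rightarrow>\<^sub>L 'a) set"
  where "peripheral_eigenspace M \<sigma> l = {x \<in> M. \<sigma> x = l *\<^sub>C x}"

definition peripheral_space ::
    "('a::complex_hilbert_space \<Rightarrow>\<^sub>L 'a) set \<Rightarrow> (('a \<Rightarrow>\<^sub>L 'a) \<Rightarrow> ('a \<Rightarrow>\<^sub>L 'a)) \<Rightarrow> ('a \<Rightarrow>\<^sub>L 'a) set"
  where "peripheral_space M \<sigma> = closure (cspan (\<Union>l\<in>{l. cmod l = 1}. peripheral_eigenspace M \<sigma> l))"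


section \<open>The minimal dilation\<close>

text \<open>The inclusion $H \subseteq K$ is an isometric embedding \<open>V\<close>. With \<open>p = range_proj V\<close> the
  projection onto (the copy of) $H$, \<open>embed_op V x\<close> is the operator on $K$ with which an
  operator \<open>x\<close> on $H$ is identified, and \<open>compression V z\<close> is the operator on $H$ that is
  identified with $pzp$.\<close>

definition isometric_embedding :: "('h::complex_hilbert_space \<Rightarrow>\<^sub>L 'k::complex_hilbert_space) \<Rightarrow> bool"
  where "isometric_embedding V \<longleftrightarrow> V \<in> clinear_ops \<and> (\<forall>h. norm (V h) = norm h)"

definition range_proj :: "('h::complex_hilbert_space \<Rightarrow>\<^sub>L 'k::complex_hilbert_space) \<Rightarrow> 'k \<Rightarrow>\<^sub>L 'k"
  where "range_proj V = V o\<^sub>L adj V"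

definition embed_op ::
    "('h::complex_hilbert_space \<Rightarrow>\<^sub>L 'k::complex_hilbert_space) \<Rightarrow> ('h \<Rightarrow>\<^sub>L 'h) \<Rightarrow> 'k \<Rightarrow>\<^sub>L 'k"
  where "embed_op V x = V o\<^sub>L x o\<^sub>L adj V"

definition compression ::
    "('h::complex_hilbert_space \<Rightarrow>\<^sub>L 'k::complex_hilbert_space) \<Rightarrow> ('k \<Rightarrow>\<^sub>L 'k) \<Rightarrow> 'h \<Rightarrow>\<^sub>L 'h"
  where "compression V z = adj V o\<^sub>L z o\<^sub>L V"

lemma embed_op_compression: "embed_op V (compression V z) = range_proj V o\<^sub>L z o\<^sub>L range_proj V"
  by (rule blinfun_eqI) (simp add: embed_op_def compression_def range_proj_def)

text \<open>\<open>dilation_word V \<theta> x n h\<close> is $\theta^n(x_n)\theta^{n-1}(x_{n-1})\cdots\theta(x_1)h$.\<close>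

primrec dilation_word ::
    "('h::complex_hilbert_space \<Rightarrow>\<^sub>L 'k::complex_hilbert_space) \<Rightarrow> (('k \<Rightarrow>\<^sub>L 'k) \<Rightarrow> ('k \<Rightarrow>\<^sub>L 'k)) \<Rightarrow>
      (nat \<Rightarrow> 'h \<Rightarrow>\<^sub>L 'h) \<Rightarrow> nat \<Rightarrow> 'h \<Rightarrow> 'k"
  where
    "dilation_word V \<theta> x 0 h = V h"
  | "dilation_word V \<theta> x (Suc n) h =
       ((\<theta> ^^ Suc n) (embed_op V (x (Suc n)))) (dilation_word V \<theta> x n h)"

definition minimal_dilation_unital ::
    "('h::complex_hilbert_space \<Rightarrow>\<^sub>L 'k::complex_hilbert_space) \<Rightarrow>
      ('h \<Rightarrow>\<^sub>L 'h) set \<Rightarrow> (('h \<Rightarrow>\<^sub>L 'h) \<Rightarrow> ('h \<Rightarrow>\<^sub>L 'h)) \<Rightarrow>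
      ('k \<Rightarrow>\<^sub>L 'k) set \<Rightarrow> (('k \<Rightarrow>\<^sub>L 'k) \<Rightarrow> ('k \<Rightarrow>\<^sub>L 'k)) \<Rightarrow> bool"
  where "minimal_dilation_unital V A \<tau> B \<theta> \<longleftrightarrow>
    isometric_embedding V \<and>
    von_neumann_algebra B \<and>
    embed_op V ` A = (\<lambda>b. range_proj V o\<^sub>L b o\<^sub>L range_proj V) ` B \<and>
    normal_star_endomorphism B \<theta> \<and>
    (\<forall>x\<in>A. \<forall>n. embed_op V ((\<tau> ^^ n) x) =
       range_proj V o\<^sub>L (\<theta> ^^ n) (embed_op V x) o\<^sub>L range_proj V) \<and>
    closure (cspan {dilation_word V \<theta> x n h | x n h. \<forall>i\<in>{1..n}. x i \<in> A}) = UNIV \<and>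
    B = generated_von_neumann_algebra {(\<theta> ^^ n) (embed_op V x) | n x. x \<in> A}"

text \<open>Unitization. \<open>direct_sum x c\<close> is $x \oplus c$; \<open>unitize_map \<sigma>\<close> is characterised by
  \<open>unitize_map_direct_sum\<close> below.\<close>

lift_definition direct_sum ::
    "('a::complex_hilbert_space \<Rightarrow>\<^sub>L 'b::complex_hilbert_space) \<Rightarrow> complex \<Rightarrow> ('a \<times> complex) \<Rightarrow>\<^sub>L ('b \<times> complex)"
  is "\<lambda>x c v. (x (fst v), c * snd v)"
proof -
  fix x :: "'a \<Rightarrow> 'b" and c :: complex
  assume "bounded_linear x"
  then show "bounded_linear (\<lambda>v. (x (fst v), c * snd v))"
    by (intro bounded_linear_Pair bounded_linear_const_mult bounded_linear_snd
        bounded_linear_compose[of x fst] bounded_linear_fst)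
qed

lemma direct_sum_eq_iff: "direct_sum x c = direct_sum y d \<longleftrightarrow> x = y \<and> c = d"
proof
  assume eq: "direct_sum x c = direct_sum y d"
  have "x h = y h" for h
    using arg_cong[OF eq, of "\<lambda>T. fst (blinfun_apply T (h, 0))"] by (simp add: direct_sum.rep_eq)
  moreover have "c = d"
    using arg_cong[OF eq, of "\<lambda>T. snd (blinfun_apply T (0, 1))"] by (simp add: direct_sum.rep_eq)
  ultimately show "x = y \<and> c = d" by (auto intro: blinfun_eqI)
qed simp

definition unitize_algebra ::
    "('a::complex_hilbert_space \<Rightarrow>\<^sub>L 'a) set \<Rightarrow> (('a \<times> complex) \<Rightarrow>\<^sub>L ('a \<times> complex)) set"
  where "unitize_algebra M = {direct_sum x c | x c. x \<in> M}"

definition unitize_map ::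
    "(('a::complex_hilbert_space \<Rightarrow>\<^sub>L 'a) \<Rightarrow> ('a \<Rightarrow>\<^sub>L 'a)) \<Rightarrow>
      (('a \<times> complex) \<Rightarrow>\<^sub>L ('a \<times> complex)) \<Rightarrow> (('a \<times> complex) \<Rightarrow>\<^sub>L ('a \<times> complex))"
  where "unitize_map \<sigma> T = (case (SOME (x, c). T = direct_sum x c) of
    (x, c) \<Rightarrow> direct_sum (\<sigma> x + c *\<^sub>C (id_blinfun - \<sigma> id_blinfun)) c)"

lemma unitize_map_direct_sum:
  "unitize_map \<sigma> (direct_sum x c) = direct_sum (\<sigma> x + c *\<^sub>C (id_blinfun - \<sigma> id_blinfun)) c"
proof -
  have "(\<lambda>(y, d). direct_sum x c = direct_sum y d) = (\<lambda>q. q = (x, c))"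
    by (auto simp: direct_sum_eq_iff)
  then have "(SOME (y, d). direct_sum x c = direct_sum y d) = (x, c)" by simp
  then show ?thesis by (simp add: unitize_map_def)
qed

text \<open>In the non-unital case $0 \oplus \mathbb{C} \subseteq \tilde H \subseteq \tilde K$ and
  $K = (0 \oplus \mathbb{C})^\perp$, so that $\tilde K = K \oplus \mathbb{C}$ and $\tilde H$ sits in
  it through $V \oplus 1$. Then $B$ and $\theta$ are the data for which
  $(K \oplus \mathbb{C}, B \oplus \mathbb{C}, \tilde\theta)$ is the minimal dilation of
  $(\tilde H, \tilde A, \tilde\tau)$.\<close>

definition minimal_dilation ::
    "('h::complex_hilbert_space \<Rightarrow>\<^sub>L 'k::complex_hilbert_space) \<Rightarrow>
      ('h \<Rightarrow>\<^sub>L 'h) set \<Rightarrow> (('h \<Rightarrow>\<^sub>L 'h) \<Rightarrow> ('h \<Rightarrow>\<^sub>L 'h)) \<Rightarrow>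
      ('k \<Rightarrow>\<^sub>L 'k) set \<Rightarrow> (('k \<Rightarrow>\<^sub>L 'k) \<Rightarrow> ('k \<Rightarrow>\<^sub>L 'k)) \<Rightarrow> bool"
  where "minimal_dilation V A \<tau> B \<theta> \<longleftrightarrow>
    (if \<tau> id_blinfun = id_blinfun then minimal_dilation_unital V A \<tau> B \<theta>
     else minimal_dilation_unital (direct_sum V 1) (unitize_algebra A) (unitize_map \<tau>)
       (unitize_algebra B) (unitize_map \<theta>))"


section \<open>Completely isometric isomorphisms\<close>

definition complete_isometric_isomorphism ::
    "(('a::complex_hilbert_space \<Rightarrow>\<^sub>L 'a) \<Rightarrow> ('b::complex_hilbert_space \<Rightarrow>\<^sub>L 'b)) \<Rightarrow>
      ('a \<Rightarrow>\<^sub>L 'a) set \<Rightarrow> ('b \<Rightarrow>\<^sub>L 'b) set \<Rightarrow> bool"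
  where "complete_isometric_isomorphism \<Phi> X Y \<longleftrightarrow>
    clinear_map_on X \<Phi> \<and> bij_betw \<Phi> X Y \<and>
    (\<forall>n z. (\<forall>i<n. \<forall>j<n. z i j \<in> X) \<longrightarrow> matrix_norm n (\<lambda>i j. \<Phi> (z i j)) = matrix_norm n z)"

end

theory Submission
  imports Defs
begin

text \<open>
  Let \<open>p\<close> be the projection onto \<open>H\<close>, and suppose first that \<open>\<tau>\<close> is unital. The projections
  \<open>P n = \<theta>\<^sup>n(p)\<close> then increase (\<open>P_mono\<close>), and minimality makes them converge strongly to \<open>1\<close>
  (\<open>P_tendsto_id\<close>). Three facts follow.

  Compression maps eigenvectors to eigenvectors (\<open>compression_eigen\<close>), because
  \<open>p \<theta>(p y p) p = p \<theta>(p) \<theta>(y) \<theta>(p) p = p \<theta>(y) p\<close>.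

  Every eigenvector \<open>x\<close> of \<open>\<tau>\<close> with unimodular eigenvalue \<open>l\<close> is the compression of one of \<open>\<theta>\<close>
  (\<open>eigen_lift\<close>), namely of the strong limit of \<open>l\<^sup>-\<^sup>n \<theta>\<^sup>n(x)\<close>. This limit exists because the
  compression of the \<open>n\<close>-th term by \<open>P m\<close> is the \<open>m\<close>-th term whenever \<open>m \<le> n\<close>, so that on the
  range of each \<open>P k\<close> the terms form a bounded martingale (\<open>coherent_sequence_strong_limit\<close>).

  Compression preserves the norms of matrices over the span of the eigenvectors
  (\<open>matrix_norm_compression\<close>). Finitely many unimodular numbers have common powers of arbitrarily
  high exponent close to \<open>1\<close> (\<open>simultaneous_recurrence\<close>), so \<open>\<theta>\<^sup>m(z)\<close> returns to \<open>z\<close> in norm along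
  a sequence of exponents \<open>m\<close>. Along that sequence \<open>\<theta>\<^sup>m(p z p) = P m \<theta>\<^sup>m(z) P m\<close> converges
  strongly to \<open>z\<close>, and \<open>\<theta>\<^sup>m\<close> is completely contractive (\<open>completely_contractive\<close>),
  whence \<open>\<parallel>z\<parallel> \<le> \<parallel>p z p\<parallel>\<close>.

  The completely isometric bijection between the spans extends to the norm closures. For \<open>\<tau>\<close>
  not unital, \<open>x \<mapsto> x \<oplus> 0\<close> embeds the eigenspaces of \<open>\<tau>\<close> and \<open>\<theta>\<close> isometrically into those of
  the unitizations, compatibly with compression, and the three facts transfer.
\<close>

section \<open>Inner products and adjoints\<close>

lemma cinner_add_left: "cinner (x + y) z = cinner x z + cinner (y::'a::complex_hilbert_space) z"
  by (metis cinner_commute cinner_add_right complex_cnj_add)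

lemma cinner_scaleC_left: "cinner (c *\<^sub>C x) y = cnj c * cinner (x::'a::complex_hilbert_space) y"
  by (metis cinner_commute cinner_scaleC_right complex_cnj_mult)

lemma cinner_self: "cinner x x = complex_of_real ((norm (x::'a::complex_hilbert_space))\<^sup>2)"
proof (rule complex_eqI)
  show "Im (cinner x x) = Im (complex_of_real ((norm x)\<^sup>2))"
    using arg_cong[OF cinner_commute[of x x], of Im] by simp
qed (simp add: inner_eq_Re_cinner[symmetric] power2_norm_eq_inner)

lemma cmod_cinner_le: "cmod (cinner x y) \<le> norm x * norm (y::'a::complex_hilbert_space)"
proof (cases "cinner x y = 0")
  case False
  \<comment> \<open>Rotate \<open>y\<close> by a phase that makes the inner product real.\<close>
  define u where "u = cnj (sgn (cinner x y))"
  have u: "cmod u = 1" using False by (simp add: u_def norm_sgn)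
  have "cinner x (u *\<^sub>C y) = complex_of_real (cmod (cinner x y))"
  proof -
    have "cnj (cinner x y) * cinner x y = complex_of_real ((cmod (cinner x y))\<^sup>2)"
      by (metis complex_norm_square mult.commute)
    then show ?thesis
      using False by (simp add: u_def cinner_scaleC_right sgn_div_norm scaleR_conv_of_real
          power2_eq_square field_simps)
  qed
  then have "cmod (cinner x y) = inner x (u *\<^sub>C y)" by (simp add: inner_eq_Re_cinner)
  also have "\<dots> \<le> norm x * norm (u *\<^sub>C y)" by (rule norm_cauchy_schwarz)
  finally show ?thesis by (simp add: norm_scaleC u)
qed simp

interpretation cinner: bounded_bilinear "cinner :: 'a::complex_hilbert_space \<Rightarrow> 'a \<Rightarrow> complex"
proof
  show "\<exists>K. \<forall>x y. norm (cinner x (y::'a)) \<le> norm x * norm y * K"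
    by (rule exI[of _ 1]) (simp add: cmod_cinner_le)
qed (simp_all add: cinner_add_left cinner_add_right scaleR_scaleC cinner_scaleC_left
    cinner_scaleC_right scaleC_complex_def)

declare cinner.zero_left [simp] cinner.zero_right [simp]

interpretation scaleC: bounded_bilinear
    "scaleC :: complex \<Rightarrow> 'a::complex_normed_vector \<Rightarrow> 'a"
proof
  show "\<exists>K. \<forall>a (x::'a). norm (a *\<^sub>C x) \<le> norm a * norm x * K"
    by (rule exI[of _ 1]) (simp add: norm_scaleC)
qed (simp_all add: scaleC_add_left scaleC_add_right scaleR_scaleC scaleC_scaleC
    scaleC_complex_def mult.commute)

lemma cinner_eqI:
  assumes "\<And>y. cinner a y = cinner b (y::'a::complex_hilbert_space)"
  shows "a = b"
proof -
  have "cinner (a - b) (a - b) = 0" using assms[of "a - b"] by (simp add: cinner.diff_left)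
  then show ?thesis by (simp add: cinner_self)
qed

lemma clinear_opsD: "T \<in> clinear_ops \<Longrightarrow> blinfun_apply T (c *\<^sub>C x) = c *\<^sub>C blinfun_apply T x"
  by (simp add: clinear_ops_def)

lemma cinner_eqI_right:
  assumes "\<And>x. cinner x a = cinner x (b::'a::complex_hilbert_space)"
  shows "a = b"
  by (rule cinner_eqI) (metis assms cinner_commute)

lemma Im_cinner: "Im (cinner y x) = - inner y (\<i> *\<^sub>C (x::'a::complex_hilbert_space))"
  by (simp add: inner_eq_Re_cinner cinner_scaleC_right)

lemma isometry_preserves_cinner:
  assumes T: "T \<in> clinear_ops" and iso: "\<And>x. norm (blinfun_apply T x) = norm x"
  shows "cinner (blinfun_apply T x) (blinfun_apply T y) = cinner x y"
proof -
  have inner: "inner (T x) (T y) = inner x y" for x y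
    by (simp add: dot_norm iso flip: blinfun.add_right)
  show ?thesis
  proof (rule complex_eqI)
    show "Re (cinner (T x) (T y)) = Re (cinner x y)" using inner by (simp add: inner_eq_Re_cinner)
    show "Im (cinner (T x) (T y)) = Im (cinner x y)"
      by (simp add: Im_cinner inner flip: clinear_opsD[OF T])
  qed
qed

text \<open>The energy \<open>\<parallel>x\<parallel>\<^sup>2/2 - \<phi>(x)\<close> is strictly convex by the parallelogram
  identity, so minimizing sequences are Cauchy; the Euler equation at the minimizer represents
  \<open>\<phi>\<close>.\<close>

lemma riesz_representation:
  fixes \<phi> :: "'a::{real_inner, complete_space} \<Rightarrow> real"
  assumes "bounded_linear \<phi>"
  shows "\<exists>y. \<forall>x. inner y x = \<phi> x"
proof -
  interpret \<phi>: bounded_linear \<phi> by fact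
  define J where "J x = (norm x)\<^sup>2 / 2 - \<phi> x" for x
  obtain K where K: "\<And>x. norm (\<phi> x) \<le> norm x * K" using \<phi>.bounded by blast
  have lower: "- K\<^sup>2 / 2 \<le> J x" for x
  proof -
    have "\<phi> x \<le> norm x * K" using K[of x] by simp
    moreover have "0 \<le> (norm x - K)\<^sup>2" by simp
    ultimately show ?thesis unfolding J_def power2_diff by simp
  qed
  have bdd: "bdd_below (range J)" using lower by (auto intro!: bdd_belowI[of _ "- K\<^sup>2 / 2"])
  define m where "m = Inf (range J)"
  have m_le: "m \<le> J x" for x unfolding m_def by (rule cINF_lower[OF bdd]) simp
  have "\<exists>x. J x < m + inverse (real (Suc n))" for n
    using cInf_less_iff[of "range J" "m + inverse (real (Suc n))"] bdd by (auto simp: m_def)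
  then obtain X where X: "\<And>n. J (X n) < m + inverse (real (Suc n))" by metis
  have par: "(norm (x - y))\<^sup>2 \<le> 4 * ((J x - m) + (J y - m))" for x y
  proof -
    have "J x + J y - 2 * J ((1/2) *\<^sub>R (x + y)) = (norm (x - y))\<^sup>2 / 4"
      unfolding J_def by (simp add: power_mult_distrib \<phi>.add \<phi>.scaleR power2_norm_eq_inner
          inner_add inner_diff inner_commute field_simps)
    with m_le[of "(1/2) *\<^sub>R (x + y)"] show ?thesis by (simp add: field_simps)
  qed
  have "Cauchy X"
  proof (rule metric_CauchyI)
    fix e :: real assume e: "0 < e"
    obtain N where N: "inverse (real (Suc N)) < e\<^sup>2 / 8"
      using reals_Archimedean[of "e\<^sup>2 / 8"] e by auto
    have "dist (X i) (X j) < e" if "i \<ge> N" "j \<ge> N" for i j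
    proof -
      have small: "J (X k) - m < e\<^sup>2 / 8" if "k \<ge> N" for k
      proof -
        have "inverse (real (Suc k)) \<le> inverse (real (Suc N))" using that by simp
        then show ?thesis using X[of k] N by linarith
      qed
      note par[of "X i" "X j"]
      also have "4 * ((J (X i) - m) + (J (X j) - m)) < 4 * (e\<^sup>2 / 8 + e\<^sup>2 / 8)"
        by (intro mult_strict_left_mono add_strict_mono small that) simp
      finally have "(norm (X i - X j))\<^sup>2 < e\<^sup>2" by simp
      then show ?thesis using e by (simp add: dist_norm power2_less_imp_less)
    qed
    then show "\<exists>N. \<forall>i\<ge>N. \<forall>j\<ge>N. dist (X i) (X j) < e" by blast
  qed
  then obtain y where y: "X \<longlonglongrightarrow> y" using Cauchy_convergent convergent_def by blast
  have "(\<lambda>n. J (X n)) \<longlonglongrightarrow> J y" unfolding J_def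
    by (intro tendsto_intros y \<phi>.tendsto) simp
  moreover have "(\<lambda>n. m + inverse (real (Suc n))) \<longlonglongrightarrow> m"
    using tendsto_add[OF tendsto_const LIMSEQ_inverse_real_of_nat, of m] by simp
  ultimately have "J y \<le> m" by (rule LIMSEQ_le) (use X less_imp_le in blast)
  then have min: "J y \<le> J x" for x using m_le[of x] by simp
  have "inner y v = \<phi> v" for v
  proof -
    define d where "d = inner y v - \<phi> v"
    define N where "N = (norm v)\<^sup>2"
    have N: "N \<ge> 0" by (simp add: N_def)
    have quad: "0 \<le> t * d + t\<^sup>2 * N / 2" for t
    proof -
      have "(norm (y + t *\<^sub>R v))\<^sup>2 = (norm y)\<^sup>2 + 2 * t * inner y v + t\<^sup>2 * (norm v)\<^sup>2"
        unfolding power2_norm_eq_inner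
        by (simp add: inner_add_left inner_add_right inner_commute[of v y] power2_eq_square
            distrib_left)
      then have "J (y + t *\<^sub>R v) - J y = t * d + t\<^sup>2 * N / 2"
        unfolding J_def d_def N_def by (simp add: \<phi>.add \<phi>.scaleR algebra_simps add_divide_distrib)
      with min[of "y + t *\<^sub>R v"] show ?thesis by linarith
    qed
    define r where "r = inverse (N + 1)"
    have r: "0 < r" "r * N < 1" using N by (auto simp: r_def field_simps)
    have "0 \<le> - (d\<^sup>2 * r) * (1 - r * N / 2)"
      using quad[of "- (d * r)"] by (simp add: power2_eq_square algebra_simps)
    moreover have "0 < 1 - r * N / 2" using r N by simp
    ultimately have "d\<^sup>2 * r \<le> 0" by (simp add: zero_le_mult_iff mult_le_0_iff)
    then have "d = 0" using r by (simp add: mult_le_0_iff)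
    then show ?thesis by (simp add: d_def)
  qed
  then show ?thesis by blast
qed

lemma adjoint_exists:
  fixes T :: "'a::complex_hilbert_space \<Rightarrow>\<^sub>L 'b::complex_hilbert_space"
  assumes T: "T \<in> clinear_ops"
  shows "\<exists>S. \<forall>x y. cinner (blinfun_apply S y) x = cinner y (T x)"
proof -
  have "\<exists>w. \<forall>x. inner w x = inner y (T x)" for y
    by (rule riesz_representation)
      (intro bounded_linear_compose[OF bounded_linear_inner_right] blinfun.bounded_linear_right)
  then obtain S where S: "\<And>y x. inner (S y) x = inner y (T x)" by metis
  have CS: "cinner (S y) x = cinner y (T x)" for x y
  proof (rule complex_eqI)
    show "Re (cinner (S y) x) = Re (cinner y (T x))" using S[of y x] by (simp add: inner_eq_Re_cinner)
    show "Im (cinner (S y) x) = Im (cinner y (T x))"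
      using S[of y "\<i> *\<^sub>C x"] by (simp add: Im_cinner clinear_opsD[OF T])
  qed
  have "bounded_linear S"
  proof (rule bounded_linear_intro)
    fix x y :: 'b and r :: real
    show "S (x + y) = S x + S y"
      by (rule cinner_eqI) (simp add: CS cinner_add_left)
    show "S (r *\<^sub>R x) = r *\<^sub>R S x"
      by (rule cinner_eqI) (simp add: CS cinner.scaleR_left)
    have "(norm (S x))\<^sup>2 = inner x (T (S x))" by (simp add: S[symmetric] power2_norm_eq_inner)
    also have "\<dots> \<le> norm x * (norm T * norm (S x))"
      by (rule order_trans[OF norm_cauchy_schwarz mult_left_mono[OF norm_blinfun]]) simp
    finally show "norm (S x) \<le> norm x * norm T"
      by (cases "S x = 0") (auto simp: power2_eq_square)
  qed
  then have "blinfun_apply (Blinfun S) = S" by (rule bounded_linear_Blinfun_apply)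
  then show ?thesis using CS by (intro exI[of _ "Blinfun S"]) simp
qed

lemma adj_eqI:
  assumes "\<And>x y. cinner (blinfun_apply S y) x = cinner y (blinfun_apply T x)"
  shows "adj T = S"
  unfolding adj_def
proof (rule the_equality)
  fix S' assume S': "\<forall>x y. cinner (blinfun_apply S' y) x = cinner y (blinfun_apply T x)"
  show "S' = S" by (rule blinfun_eqI, rule cinner_eqI) (simp add: S' assms)
qed (simp add: assms)

lemma cinner_adj_left:
  assumes "T \<in> clinear_ops"
  shows "cinner (blinfun_apply (adj T) y) x = cinner y (blinfun_apply T x)"
  using adjoint_exists[OF assms] adj_eqI by metis

lemma cinner_adj_right:
  assumes "T \<in> clinear_ops"
  shows "cinner x (blinfun_apply (adj T) y) = cinner (blinfun_apply T x) y"
  by (metis assms cinner_adj_left cinner_commute)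

lemma adj_clinear:
  assumes "T \<in> clinear_ops"
  shows "adj T \<in> clinear_ops"
  unfolding clinear_ops_def
proof (intro CollectI allI)
  fix c x
  show "blinfun_apply (adj T) (c *\<^sub>C x) = c *\<^sub>C blinfun_apply (adj T) x"
    by (rule cinner_eqI) (simp add: cinner_adj_left[OF assms] cinner_scaleC_left)
qed

lemma adj_adj: "T \<in> clinear_ops \<Longrightarrow> adj (adj T) = T"
  by (rule adj_eqI) (simp add: cinner_adj_right)

lemma adj_compose:
  assumes "S \<in> clinear_ops" "T \<in> clinear_ops"
  shows "adj (S o\<^sub>L T) = adj T o\<^sub>L adj S"
  by (rule adj_eqI) (simp add: cinner_adj_left assms)

lemma clinear_compose: "S \<in> clinear_ops \<Longrightarrow> T \<in> clinear_ops \<Longrightarrow> S o\<^sub>L T \<in> clinear_ops"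
  by (simp add: clinear_ops_def)


section \<open>Tuples and operator matrices\<close>

text \<open>A vector of the \<open>n\<close>-fold direct sum is a function on \<open>nat\<close> whose values at indices
  \<open>\<ge> n\<close> are ignored.\<close>

definition tuple_norm :: "nat \<Rightarrow> (nat \<Rightarrow> 'a::real_normed_vector) \<Rightarrow> real"
  where "tuple_norm n x = L2_set (\<lambda>i. norm (x i)) {..<n}"

definition tuple_inner :: "nat \<Rightarrow> (nat \<Rightarrow> 'a::complex_hilbert_space) \<Rightarrow> (nat \<Rightarrow> 'a) \<Rightarrow> complex"
  where "tuple_inner n x y = (\<Sum>i<n. cinner (x i) (y i))"

definition mat_apply ::
    "nat \<Rightarrow> (nat \<Rightarrow> nat \<Rightarrow> 'a::real_normed_vector \<Rightarrow>\<^sub>L 'b::real_normed_vector) \<Rightarrow> (nat \<Rightarrow> 'a) \<Rightarrow> nat \<Rightarrow> 'b"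
  where "mat_apply n a x i = (\<Sum>j<n. a i j (x j))"

lemma tuple_norm_nonneg [simp]: "0 \<le> tuple_norm n x"
  by (simp add: tuple_norm_def)

lemma tuple_norm_square: "(tuple_norm n x)\<^sup>2 = (\<Sum>i<n. (norm (x i))\<^sup>2)"
  by (simp add: tuple_norm_def L2_set_def sum_nonneg)

lemma tuple_norm_cong: "(\<And>i. i < n \<Longrightarrow> norm (x i) = norm (y i)) \<Longrightarrow> tuple_norm n x = tuple_norm n y"
  by (auto simp: tuple_norm_def intro: L2_set_cong)

lemma tuple_norm_mono: "(\<And>i. i < n \<Longrightarrow> norm (x i) \<le> norm (y i)) \<Longrightarrow> tuple_norm n x \<le> tuple_norm n y"
  by (auto simp: tuple_norm_def intro: L2_set_mono)

lemma tuple_norm_triangle: "tuple_norm n (\<lambda>i. x i + y i) \<le> tuple_norm n x + tuple_norm n y"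
proof -
  have "tuple_norm n (\<lambda>i. x i + y i) \<le> L2_set (\<lambda>i. norm (x i) + norm (y i)) {..<n}"
    unfolding tuple_norm_def by (intro L2_set_mono norm_triangle_ineq) simp
  also have "\<dots> \<le> tuple_norm n x + tuple_norm n y"
    unfolding tuple_norm_def by (rule L2_set_triangle_ineq)
  finally show ?thesis .
qed

lemma tuple_norm_scaleR: "tuple_norm n (\<lambda>i. r *\<^sub>R x i) = \<bar>r\<bar> * tuple_norm n x"
  by (simp add: tuple_norm_def L2_set_right_distrib)

lemma norm_le_tuple_norm: "i < n \<Longrightarrow> norm (x i) \<le> tuple_norm n x"
  unfolding tuple_norm_def by (rule member_le_L2_set) auto

lemma tuple_norm_le_sum: "tuple_norm n x \<le> (\<Sum>i<n. norm (x i))"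
  unfolding tuple_norm_def by (rule L2_set_le_sum) simp

lemma tuple_norm_single: "j < n \<Longrightarrow> tuple_norm n (\<lambda>k. if k = j then v else 0) = norm v"
  by (simp add: tuple_norm_def L2_set_def if_distrib[of norm] if_distrib[of "\<lambda>t. t\<^sup>2"] cong: if_cong)

lemma tendsto_tuple_norm:
  assumes "\<And>i. i < n \<Longrightarrow> ((\<lambda>k. X k i) \<longlongrightarrow> x i) F"
  shows "((\<lambda>k. tuple_norm n (X k)) \<longlongrightarrow> tuple_norm n x) F"
  unfolding tuple_norm_def L2_set_def by (intro tendsto_intros assms) simp

lemma cmod_tuple_inner_le: "cmod (tuple_inner n x y) \<le> tuple_norm n x * tuple_norm n y"
proof -
  have "cmod (tuple_inner n x y) \<le> (\<Sum>i<n. norm (x i) * norm (y i))"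
    unfolding tuple_inner_def by (intro order_trans[OF norm_sum] sum_mono cmod_cinner_le)
  also have "\<dots> \<le> tuple_norm n x * tuple_norm n y"
    using L2_set_mult_ineq[of "\<lambda>i. norm (x i)" "\<lambda>i. norm (y i)" "{..<n}"] by (simp add: tuple_norm_def)
  finally show ?thesis .
qed

lemma tuple_inner_self: "tuple_inner n x x = complex_of_real ((tuple_norm n x)\<^sup>2)"
  by (simp add: tuple_inner_def cinner_self tuple_norm_square)

lemma mat_apply_single: "j < n \<Longrightarrow> mat_apply n a (\<lambda>k. if k = j then v else 0) i = a i j v"
  by (simp add: mat_apply_def if_distrib[of "blinfun_apply _"] cong: if_cong)

lemma tuple_norm_mat_apply_le_sum:
  "tuple_norm n (mat_apply n a x) \<le> (\<Sum>i<n. \<Sum>j<n. norm (a i j)) * tuple_norm n x"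
proof -
  have "norm (mat_apply n a x i) \<le> (\<Sum>j<n. norm (a i j)) * tuple_norm n x" for i
    unfolding mat_apply_def sum_distrib_right
    by (intro order_trans[OF norm_sum] sum_mono order_trans[OF norm_blinfun] mult_left_mono
        norm_le_tuple_norm) auto
  then have "(\<Sum>i<n. norm (mat_apply n a x i)) \<le> (\<Sum>i<n. (\<Sum>j<n. norm (a i j)) * tuple_norm n x)"
    by (intro sum_mono)
  with tuple_norm_le_sum[of n "mat_apply n a x"] show ?thesis by (simp add: sum_distrib_right)
qed

lemma matrix_norm_tuple_norm:
  "matrix_norm n a = (SUP x\<in>{x. tuple_norm n x \<le> 1}. tuple_norm n (mat_apply n a x))"
proof -
  have "(\<Sum>j<n. (norm (x j))\<^sup>2) \<le> 1 \<longleftrightarrow> tuple_norm n x \<le> 1" for x :: "nat \<Rightarrow> 'a"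
    by (simp add: tuple_norm_def L2_set_def)
  then show ?thesis by (simp add: matrix_norm_def tuple_norm_def L2_set_def mat_apply_def)
qed

lemma tuple_norm_mat_apply_le_matrix_norm1:
  assumes "tuple_norm n x \<le> 1"
  shows "tuple_norm n (mat_apply n a x) \<le> matrix_norm n a"
  unfolding matrix_norm_tuple_norm
proof (rule cSUP_upper)
  show "bdd_above ((\<lambda>x. tuple_norm n (mat_apply n a x)) ` {x. tuple_norm n x \<le> 1})"
  proof (rule bdd_aboveI2)
    fix x :: "nat \<Rightarrow> 'a" assume "x \<in> {x. tuple_norm n x \<le> 1}"
    then show "tuple_norm n (mat_apply n a x) \<le> (\<Sum>i<n. \<Sum>j<n. norm (a i j)) * 1"
      by (intro order_trans[OF tuple_norm_mat_apply_le_sum] mult_left_mono) (auto intro!: sum_nonneg)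
  qed
qed (use assms in simp)

lemma matrix_norm_leI:
  assumes "\<And>x. tuple_norm n x \<le> 1 \<Longrightarrow> tuple_norm n (mat_apply n a x) \<le> c"
  shows "matrix_norm n a \<le> c"
  unfolding matrix_norm_tuple_norm
proof (rule cSUP_least)
  have "tuple_norm n (\<lambda>_. 0 :: 'a) \<le> 1" by (simp add: tuple_norm_def L2_set_def)
  then show "{x :: nat \<Rightarrow> 'a. tuple_norm n x \<le> 1} \<noteq> {}" by blast
qed (use assms in simp)

lemma matrix_norm_nonneg [simp]: "0 \<le> matrix_norm n a"
  by (rule order_trans[OF tuple_norm_nonneg tuple_norm_mat_apply_le_matrix_norm1[where x="\<lambda>_. 0"]])
    (simp add: tuple_norm_def L2_set_def)

lemma tuple_norm_mat_apply_le:
  "tuple_norm n (mat_apply n a x) \<le> matrix_norm n a * tuple_norm n x"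
proof (cases "tuple_norm n x = 0")
  case True
  then show ?thesis using tuple_norm_mat_apply_le_sum[of n a x] by simp
next
  case False
  define r where "r = tuple_norm n x"
  have r: "r > 0" using False tuple_norm_nonneg[of n x] unfolding r_def by linarith
  have "tuple_norm n (mat_apply n a (\<lambda>i. inverse r *\<^sub>R x i)) \<le> matrix_norm n a"
    by (rule tuple_norm_mat_apply_le_matrix_norm1)
      (use r in \<open>simp add: tuple_norm_scaleR r_def[symmetric]\<close>)
  moreover have "mat_apply n a (\<lambda>i. inverse r *\<^sub>R x i) = (\<lambda>i. inverse r *\<^sub>R mat_apply n a x i)"
    by (auto simp: mat_apply_def blinfun.scaleR_right scaleR_sum_right)
  ultimately show ?thesis using r by (simp add: tuple_norm_scaleR r_def[symmetric] field_simps)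
qed

lemma norm_entry_le_matrix_norm:
  assumes "i < n" "j < n"
  shows "norm (a i j) \<le> matrix_norm n a"
proof (rule norm_blinfun_bound)
  fix v
  have "norm (a i j v) = norm (mat_apply n a (\<lambda>k. if k = j then v else 0) i)"
    by (simp add: mat_apply_single assms)
  also have "\<dots> \<le> tuple_norm n (mat_apply n a (\<lambda>k. if k = j then v else 0))"
    by (rule norm_le_tuple_norm[OF assms(1)])
  also have "\<dots> \<le> matrix_norm n a * tuple_norm n (\<lambda>k. if k = j then v else 0)"
    by (rule tuple_norm_mat_apply_le)
  finally show "norm (a i j v) \<le> matrix_norm n a * norm v" by (simp add: tuple_norm_single assms)
qed simp

lemma matrix_norm_one:
  fixes T :: "'a::complex_hilbert_space \<Rightarrow>\<^sub>L 'b::complex_hilbert_space"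
  shows "matrix_norm 1 (\<lambda>_ _. T) = norm T"
proof (rule antisym)
  show "matrix_norm 1 (\<lambda>_ _. T) \<le> norm T"
  proof (rule matrix_norm_leI)
    fix x :: "nat \<Rightarrow> 'a" assume "tuple_norm 1 x \<le> 1"
    then show "tuple_norm 1 (mat_apply 1 (\<lambda>_ _. T) x) \<le> norm T"
      using order_trans[OF norm_blinfun[of T "x 0"] mult_left_mono[of "norm (x 0)" 1 "norm T"]]
      by (simp add: tuple_norm_def mat_apply_def L2_set_def)
  qed
  show "norm T \<le> matrix_norm 1 (\<lambda>_ _. T)" using norm_entry_le_matrix_norm[of 0 1 0 "\<lambda>_ _. T"] by simp
qed

lemma matrix_norm_le_add:
  fixes a :: "nat \<Rightarrow> nat \<Rightarrow> 'a::complex_hilbert_space \<Rightarrow>\<^sub>L 'b::complex_hilbert_space"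
  shows
  "matrix_norm n a \<le> matrix_norm n b + (\<Sum>i<n. \<Sum>j<n. norm (a i j - b i j))"
proof (rule matrix_norm_leI)
  fix x :: "nat \<Rightarrow> 'a" assume x: "tuple_norm n x \<le> 1"
  let ?d = "\<lambda>i j. a i j - b i j"
  have "mat_apply n a x = (\<lambda>i. mat_apply n b x i + mat_apply n ?d x i)"
    by (auto simp: mat_apply_def blinfun.diff_left sum_subtractf)
  then have "tuple_norm n (mat_apply n a x)
      \<le> tuple_norm n (mat_apply n b x) + tuple_norm n (mat_apply n ?d x)"
    by (simp add: tuple_norm_triangle)
  also have "tuple_norm n (mat_apply n b x) \<le> matrix_norm n b"
    by (rule tuple_norm_mat_apply_le_matrix_norm1[OF x])
  also have "tuple_norm n (mat_apply n ?d x) \<le> (\<Sum>i<n. \<Sum>j<n. norm (?d i j)) * 1"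
    by (intro order_trans[OF tuple_norm_mat_apply_le_sum] mult_left_mono x sum_nonneg) auto
  finally show "tuple_norm n (mat_apply n a x) \<le> matrix_norm n b + (\<Sum>i<n. \<Sum>j<n. norm (?d i j))"
    by simp
qed

lemma tendsto_matrix_norm:
  assumes "\<And>i j. i < n \<Longrightarrow> j < n \<Longrightarrow> (\<lambda>k. a k i j) \<longlonglongrightarrow> b i j"
  shows "(\<lambda>k. matrix_norm n (a k)) \<longlonglongrightarrow> matrix_norm n b"
proof (rule LIM_zero_cancel, rule Lim_null_comparison)
  let ?e = "\<lambda>k. \<Sum>i<n. \<Sum>j<n. norm (a k i j - b i j)"
  have "\<bar>matrix_norm n (a k) - matrix_norm n b\<bar> \<le> ?e k" for k
    using matrix_norm_le_add[of n "a k" b] matrix_norm_le_add[of n b "a k"]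
    by (simp add: norm_minus_commute)
  then show "\<forall>\<^sub>F k in sequentially. norm (matrix_norm n (a k) - matrix_norm n b) \<le> ?e k" by simp
  have "?e \<longlonglongrightarrow> (\<Sum>i<n. \<Sum>j<n. norm (b i j - b i j))"
    by (intro tendsto_intros assms) auto
  then show "?e \<longlonglongrightarrow> 0" by simp
qed

definition mat_mult ::
    "nat \<Rightarrow> (nat \<Rightarrow> nat \<Rightarrow> 'b::real_normed_vector \<Rightarrow>\<^sub>L 'c::real_normed_vector) \<Rightarrow>
      (nat \<Rightarrow> nat \<Rightarrow> 'a::real_normed_vector \<Rightarrow>\<^sub>L 'b) \<Rightarrow> nat \<Rightarrow> nat \<Rightarrow> 'a \<Rightarrow>\<^sub>L 'c"
  where "mat_mult n a b i j = (\<Sum>k<n. a i k o\<^sub>L b k j)"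

definition mat_adj ::
    "(nat \<Rightarrow> nat \<Rightarrow> 'a::complex_hilbert_space \<Rightarrow>\<^sub>L 'b::complex_hilbert_space) \<Rightarrow> nat \<Rightarrow> nat \<Rightarrow> 'b \<Rightarrow>\<^sub>L 'a"
  where "mat_adj a i j = adj (a j i)"

lemma mat_apply_mat_mult: "mat_apply n (mat_mult n a b) x = mat_apply n a (mat_apply n b x)"
proof
  fix i
  have "mat_apply n (mat_mult n a b) x i = (\<Sum>j<n. \<Sum>k<n. a i k (b k j (x j)))"
    by (simp add: mat_apply_def mat_mult_def blinfun.sum_left)
  also have "\<dots> = (\<Sum>k<n. \<Sum>j<n. a i k (b k j (x j)))" by (rule sum.swap)
  also have "\<dots> = mat_apply n a (mat_apply n b x) i"
    by (simp add: mat_apply_def blinfun.sum_right)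
  finally show "mat_apply n (mat_mult n a b) x i = mat_apply n a (mat_apply n b x) i" .
qed

lemma tuple_inner_mat_adj:
  assumes "\<And>i j. i < n \<Longrightarrow> j < n \<Longrightarrow> a i j \<in> clinear_ops"
  shows "tuple_inner n x (mat_apply n (mat_adj a) y) = tuple_inner n (mat_apply n a x) y"
proof -
  have "tuple_inner n x (mat_apply n (mat_adj a) y) = (\<Sum>i<n. \<Sum>j<n. cinner (a j i (x i)) (y j))"
    by (simp add: tuple_inner_def mat_apply_def mat_adj_def cinner.sum_right cinner_adj_right assms)
  also have "\<dots> = (\<Sum>j<n. \<Sum>i<n. cinner (a j i (x i)) (y j))" by (rule sum.swap)
  finally show ?thesis by (simp add: tuple_inner_def mat_apply_def cinner.sum_left)
qed

lemma matrix_norm_mat_mult: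
  fixes b :: "nat \<Rightarrow> nat \<Rightarrow> 'a::complex_hilbert_space \<Rightarrow>\<^sub>L 'b::complex_hilbert_space"
  shows "matrix_norm n (mat_mult n a b) \<le> matrix_norm n a * matrix_norm n b"
proof (rule matrix_norm_leI)
  fix x :: "nat \<Rightarrow> 'a" assume x: "tuple_norm n x \<le> 1"
  show "tuple_norm n (mat_apply n (mat_mult n a b) x) \<le> matrix_norm n a * matrix_norm n b"
    unfolding mat_apply_mat_mult
    by (intro order_trans[OF tuple_norm_mat_apply_le] mult_left_mono
        tuple_norm_mat_apply_le_matrix_norm1[OF x]) auto
qed

lemma matrix_norm_mat_adj:
  fixes a :: "nat \<Rightarrow> nat \<Rightarrow> 'a::complex_hilbert_space \<Rightarrow>\<^sub>L 'b::complex_hilbert_space"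
  assumes "\<And>i j. i < n \<Longrightarrow> j < n \<Longrightarrow> a i j \<in> clinear_ops"
  shows "matrix_norm n (mat_adj a) \<le> matrix_norm n a"
proof (rule matrix_norm_leI)
  fix x :: "nat \<Rightarrow> 'b" assume x: "tuple_norm n x \<le> 1"
  let ?y = "mat_apply n (mat_adj a) x"
  have "complex_of_real ((tuple_norm n ?y)\<^sup>2) = tuple_inner n (mat_apply n a ?y) x"
    by (simp only: tuple_inner_self[symmetric] tuple_inner_mat_adj[OF assms])
  then have "(tuple_norm n ?y)\<^sup>2 \<le> tuple_norm n (mat_apply n a ?y) * tuple_norm n x"
    using cmod_tuple_inner_le[of n "mat_apply n a ?y" x] by (metis norm_of_real abs_power2 power2_abs)
  also have "\<dots> \<le> (matrix_norm n a * tuple_norm n ?y) * 1"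
    by (intro mult_mono tuple_norm_mat_apply_le x) auto
  finally show "tuple_norm n ?y \<le> matrix_norm n a"
    by (cases "tuple_norm n ?y = 0") (auto simp: power2_eq_square order_less_le)
qed


section \<open>Strong limits in von Neumann algebras and normality\<close>

lemma scaleC_blinfun_apply: "blinfun_apply (c *\<^sub>C T) x = c *\<^sub>C blinfun_apply T x"
  by (simp add: scaleC_blinfun.rep_eq)

lemma compose_scaleC_left: "(c *\<^sub>C S) o\<^sub>L T = c *\<^sub>C (S o\<^sub>L T)"
  by (rule blinfun_eqI) (simp add: scaleC_blinfun_apply)

lemma compose_scaleC_right: "S \<in> clinear_ops \<Longrightarrow> S o\<^sub>L (c *\<^sub>C T) = c *\<^sub>C (S o\<^sub>L T)"
  by (rule blinfun_eqI) (simp add: scaleC_blinfun_apply clinear_opsD)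

lemma blinfun_compose_assoc: "(R o\<^sub>L S) o\<^sub>L T = R o\<^sub>L (S o\<^sub>L T)"
  by (rule blinfun_eqI) simp

lemma blinfun_compose_id: "T o\<^sub>L id_blinfun = T"
  by (rule blinfun_eqI) simp

lemma von_neumann_algebra_strong_limit:
  assumes M: "von_neumann_algebra M" and T: "\<And>n. T n \<in> M"
    and lim: "\<And>x. (\<lambda>n. blinfun_apply (T n) x) \<longlonglongrightarrow> blinfun_apply S x"
  shows "S \<in> M"
proof -
  have "limitin (product_topology (\<lambda>_. euclidean) UNIV) (\<lambda>n. blinfun_apply (T n)) (blinfun_apply S) sequentially"
    using lim by (simp add: limitin_componentwise)
  then have "((\<lambda>n. blinfun_apply (T n)) \<longlongrightarrow> blinfun_apply S) sequentially"
    by (simp add: euclidean_product_topology)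
  then have "limitin strong_operator_topology T S sequentially"
    unfolding limitin_def strong_operator_topology_topspace
    by (auto simp: strong_operator_topology_def openin_pullback_topology elim!: topological_tendstoD)
  then show ?thesis
    using M T by (intro limitin_closedin[of strong_operator_topology T S sequentially])
      (auto simp: von_neumann_algebra_def)
qed

lemma limitin_topology_generated_by:
  assumes "l \<in> topspace (topology_generated_by \<S>)"
    and "\<And>U. U \<in> \<S> \<Longrightarrow> l \<in> U \<Longrightarrow> eventually (\<lambda>x. f x \<in> U) F"
  shows "limitin (topology_generated_by \<S>) f l F"
  unfolding limitin_def openin_topology_generated_by_iff
proof (intro conjI allI impI)
  fix U assume "generate_topology_on \<S> U \<and> l \<in> U"
  then have "generate_topology_on \<S> U" "l \<in> U" by auto
  then show "eventually (\<lambda>x. f x \<in> U) F"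
  proof (induction rule: generate_topology_on.induct)
    case (Int a b)
    then show ?case by (auto intro: eventually_conj)
  next
    case (UN K)
    then obtain k where "k \<in> K" "l \<in> k" by blast
    then have "eventually (\<lambda>x. f x \<in> k) F" using UN by blast
    then show ?case by (rule eventually_mono) (use \<open>k \<in> K\<close> in blast)
  qed (use assms in auto)
qed (use assms in simp)

text \<open>Ultraweak functionals are series \<open>\<Sum>k. \<langle>x\<^sub>k, T y\<^sub>k\<rangle>\<close>; boundedness
  dominates them, so the limit may be taken termwise.\<close>

lemma bounded_strong_limit_ultraweak:
  fixes S :: "'a::complex_hilbert_space \<Rightarrow>\<^sub>L 'a"
  assumes bound: "\<And>n. norm (T n) \<le> C"
    and lim: "\<And>x. (\<lambda>n. blinfun_apply (T n) x) \<longlonglongrightarrow> blinfun_apply S x"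
  shows "limitin ultraweak_topology T S sequentially"
  unfolding ultraweak_topology_def
proof (rule limitin_topology_generated_by)
  show "S \<in> topspace (topology_generated_by
    {(\<lambda>T. \<Sum>k. cinner (x k) (blinfun_apply T (y k))) -` U | (x :: nat \<Rightarrow> 'a) y U.
       summable (\<lambda>k. (norm (x k))\<^sup>2) \<and> summable (\<lambda>k. (norm (y k))\<^sup>2) \<and> open U})"
  proof (rule topology_generated_by_Basis[THEN openin_subset, THEN subsetD])
    let ?z = "\<lambda>_::nat. 0 :: 'a"
    show "UNIV \<in> {(\<lambda>T. \<Sum>k. cinner (x k) (blinfun_apply T (y k))) -` U | (x :: nat \<Rightarrow> 'a) (y :: nat \<Rightarrow> 'a) U.
       summable (\<lambda>k. (norm (x k))\<^sup>2) \<and> summable (\<lambda>k. (norm (y k))\<^sup>2) \<and> open U}"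
    proof (rule CollectI, intro exI conjI)
      show "UNIV = (\<lambda>T. \<Sum>k. cinner (?z k) (blinfun_apply T (?z k))) -` UNIV" by simp
    qed auto
  qed simp
next
  fix W assume "W \<in> {(\<lambda>T. \<Sum>k. cinner (x k) (blinfun_apply T (y k))) -` U | (x :: nat \<Rightarrow> 'a) y U.
       summable (\<lambda>k. (norm (x k))\<^sup>2) \<and> summable (\<lambda>k. (norm (y k))\<^sup>2) \<and> open U}" and "S \<in> W"
  then obtain x y :: "nat \<Rightarrow> 'a" and U where xy: "summable (\<lambda>k. (norm (x k))\<^sup>2)"
      "summable (\<lambda>k. (norm (y k))\<^sup>2)" and U: "open U"
      "(\<Sum>k. cinner (x k) (blinfun_apply S (y k))) \<in> U"
      and W: "W = (\<lambda>T. \<Sum>k. cinner (x k) (blinfun_apply T (y k))) -` U" by auto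
  have C: "C \<ge> 0" using order_trans[OF norm_ge_zero bound[of 0]] .
  let ?m = "\<lambda>k. C * ((norm (x k))\<^sup>2 + (norm (y k))\<^sup>2)"
  have dom: "cmod (cinner (x k) (T n (y k))) \<le> ?m k" for n k
  proof -
    have "cmod (cinner (x k) (T n (y k))) \<le> norm (x k) * (C * norm (y k))"
      by (intro order_trans[OF cmod_cinner_le] mult_left_mono order_trans[OF norm_blinfun]
          mult_right_mono bound) auto
    also have "\<dots> = C * (norm (x k) * norm (y k))" by simp
    also have "\<dots> \<le> ?m k"
    proof (rule mult_left_mono[OF _ C])
      have "0 \<le> (norm (x k) - norm (y k))\<^sup>2" by simp
      moreover have "0 \<le> norm (x k) * norm (y k)" by simp
      ultimately show "norm (x k) * norm (y k) \<le> (norm (x k))\<^sup>2 + (norm (y k))\<^sup>2"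
        unfolding power2_diff by linarith
    qed
    finally show ?thesis .
  qed
  have "(\<lambda>n. \<Sum>k. cinner (x k) (T n (y k))) \<longlonglongrightarrow> (\<Sum>k. cinner (x k) (S (y k)))"
  proof (rule tannerys_theorem[THEN conjunct2, THEN conjunct2])
    show "(\<lambda>n. cinner (x k) (T n (y k))) \<longlonglongrightarrow> cinner (x k) (S (y k))" for k
      by (intro cinner.tendsto tendsto_const lim)
    show "\<forall>\<^sub>F (k, n) in sequentially \<times>\<^sub>F sequentially. cmod (cinner (x k) (T n (y k))) \<le> ?m k"
      using dom by (auto intro!: always_eventually)
    show "summable ?m" by (intro summable_mult summable_add xy)
  qed simp
  then have "\<forall>\<^sub>F n in sequentially. (\<Sum>k. cinner (x k) (T n (y k))) \<in> U"
    by (rule topological_tendstoD[OF _ U])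
  then show "\<forall>\<^sub>F n in sequentially. T n \<in> W" by (simp add: W)
qed

lemma ultraweak_limit_coefficient:
  fixes S :: "'a::complex_hilbert_space \<Rightarrow>\<^sub>L 'a"
  assumes lim: "limitin ultraweak_topology T S sequentially"
  shows "(\<lambda>n. cinner x (blinfun_apply (T n) y)) \<longlonglongrightarrow> cinner x (blinfun_apply S y)"
proof (rule topological_tendstoI)
  fix U assume U: "open U" "cinner x (blinfun_apply S y) \<in> U"
  define X where "X k = (if k = 0 then x else 0)" for k :: nat
  define Y where "Y k = (if k = 0 then y else 0)" for k :: nat
  let ?W = "(\<lambda>T. \<Sum>k. cinner (X k) (blinfun_apply T (Y k))) -` U"
  have series: "(\<Sum>k. cinner (X k) (blinfun_apply T (Y k))) = cinner x (blinfun_apply T y)" for T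
    by (subst suminf_finite[of "{0}"]) (auto simp: X_def Y_def)
  have fin: "summable (\<lambda>k. (norm (X k))\<^sup>2)" "summable (\<lambda>k. (norm (Y k))\<^sup>2)"
    by (rule summable_finite[of "{0}"]; simp add: X_def Y_def)+
  have "openin ultraweak_topology ?W"
    unfolding ultraweak_topology_def by (rule topology_generated_by_Basis) (use U fin in blast)
  moreover have "S \<in> ?W" using U by (simp add: series)
  ultimately have "\<forall>\<^sub>F n in sequentially. T n \<in> ?W" using lim unfolding limitin_def by blast
  then show "\<forall>\<^sub>F n in sequentially. cinner x (blinfun_apply (T n) y) \<in> U" by (simp add: series)
qed

locale normal_endomorphism =
  fixes M :: "('a::complex_hilbert_space \<Rightarrow>\<^sub>L 'a) set" and \<theta>
  assumes algebra: "von_neumann_algebra M" and endo: "normal_star_endomorphism M \<theta>"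
begin

lemma clinear: "T \<in> M \<Longrightarrow> T \<in> clinear_ops"
  and add_closed: "S \<in> M \<Longrightarrow> T \<in> M \<Longrightarrow> S + T \<in> M"
  and compose_closed: "S \<in> M \<Longrightarrow> T \<in> M \<Longrightarrow> S o\<^sub>L T \<in> M"
  and scaleC_closed: "T \<in> M \<Longrightarrow> c *\<^sub>C T \<in> M"
  and adj_closed: "T \<in> M \<Longrightarrow> adj T \<in> M"
  using algebra by (auto simp: von_neumann_algebra_def)

lemma image_closed: "T \<in> M \<Longrightarrow> \<theta> T \<in> M"
  and image_add: "S \<in> M \<Longrightarrow> T \<in> M \<Longrightarrow> \<theta> (S + T) = \<theta> S + \<theta> T"
  and image_compose: "S \<in> M \<Longrightarrow> T \<in> M \<Longrightarrow> \<theta> (S o\<^sub>L T) = \<theta> S o\<^sub>L \<theta> T"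
  and image_scaleC: "T \<in> M \<Longrightarrow> \<theta> (c *\<^sub>C T) = c *\<^sub>C \<theta> T"
  and image_adj: "T \<in> M \<Longrightarrow> \<theta> (adj T) = adj (\<theta> T)"
  using endo by (auto simp: normal_star_endomorphism_def clinear_map_on_def)

lemma zero_closed: "0 \<in> M"
proof -
  have "id_blinfun \<in> M" using algebra by (simp add: von_neumann_algebra_def)
  from scaleC_closed[OF this, of 0] show ?thesis by simp
qed

lemma image_zero: "\<theta> 0 = 0"
  using image_scaleC[OF zero_closed, of 0] by simp

lemma sum_closed: "(\<And>i. i \<in> I \<Longrightarrow> f i \<in> M) \<Longrightarrow> sum f I \<in> M"
  by (induction I rule: infinite_finite_induct) (auto simp: zero_closed add_closed)

lemma image_sum: "(\<And>i. i \<in> I \<Longrightarrow> f i \<in> M) \<Longrightarrow> \<theta> (sum f I) = (\<Sum>i\<in>I. \<theta> (f i))"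
  by (induction I rule: infinite_finite_induct) (auto simp: image_zero image_add sum_closed)

lemma funpow_endomorphism: "normal_endomorphism M (\<theta> ^^ n)"
proof
  show "normal_star_endomorphism M (\<theta> ^^ n)"
  proof (induction n)
    case 0
    show ?case by (simp add: normal_star_endomorphism_def clinear_map_on_def normal_map_on_def)
  next
    case (Suc n)
    interpret n: normal_endomorphism M "\<theta> ^^ n" by standard (rule algebra, rule Suc)
    have "normal_map_on M (\<theta> ^^ Suc n)"
      using endo Suc unfolding normal_star_endomorphism_def normal_map_on_def funpow.simps
      by (blast intro: continuous_map_compose)
    then show ?case
      by (simp add: normal_star_endomorphism_def clinear_map_on_def n.image_closed image_closed
          n.image_add image_add n.image_scaleC image_scaleC n.image_compose image_compose
          n.image_adj image_adj comp_def Pi_iff)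
  qed
qed (rule algebra)

lemma coefficient_tendsto:
  assumes "\<And>n. T n \<in> M" "S \<in> M" "\<And>n. norm (T n) \<le> C"
    and "\<And>x. (\<lambda>n. blinfun_apply (T n) x) \<longlonglongrightarrow> blinfun_apply S x"
  shows "(\<lambda>n. cinner x (blinfun_apply (\<theta> (T n)) y)) \<longlonglongrightarrow> cinner x (blinfun_apply (\<theta> S) y)"
proof -
  have "limitin (subtopology ultraweak_topology M) T S sequentially"
    using assms bounded_strong_limit_ultraweak[of T C S] by (simp add: limitin_subtopology)
  moreover have "continuous_map (subtopology ultraweak_topology M) (subtopology ultraweak_topology M) \<theta>"
    using endo by (simp add: normal_star_endomorphism_def normal_map_on_def)
  ultimately have "limitin (subtopology ultraweak_topology M) (\<theta> \<circ> T) (\<theta> S) sequentially"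
    by (rule continuous_map_limit[rotated])
  then have "limitin ultraweak_topology (\<lambda>n. \<theta> (T n)) (\<theta> S) sequentially"
    by (simp add: limitin_subtopology comp_def)
  then show ?thesis by (rule ultraweak_limit_coefficient)
qed

text \<open>Normality enters the norm estimates only through this crude bound, in which the constant
  may depend on the vectors: an unbounded coefficient would be of modulus \<open>> 1\<close> on a norm null
  sequence.\<close>

lemma coefficient_bounded:
  obtains C where "C \<ge> 0" "\<And>T. T \<in> M \<Longrightarrow> cmod (cinner x (blinfun_apply (\<theta> T) y)) \<le> C * norm T"
proof -
  let ?f = "\<lambda>T. cinner x (blinfun_apply (\<theta> T) y)"
  have "\<exists>C\<ge>0. \<forall>T\<in>M. cmod (?f T) \<le> C * norm T"
  proof (rule ccontr)
    assume neg: "\<not> ?thesis"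
    have "\<exists>T\<in>M. norm T = inverse (real (Suc n)) \<and> cmod (?f T) > 1" for n
    proof -
      obtain T where T: "T \<in> M" "cmod (?f T) > real (Suc n) * norm T"
        using neg by (metis not_le of_nat_0_le_iff)
      have pos: "norm T > 0"
      proof -
        have "T \<noteq> 0" using T by (auto simp: image_zero)
        then show ?thesis by simp
      qed
      define r where "r = inverse (real (Suc n) * norm T)"
      have r: "r > 0" using pos by (simp add: r_def)
      have "?f (complex_of_real r *\<^sub>C T) = complex_of_real r * ?f T"
        by (simp add: image_scaleC T scaleC_blinfun_apply cinner_scaleC_right)
      then have "cmod (?f (complex_of_real r *\<^sub>C T)) = r * cmod (?f T)"
        using r by (simp add: norm_mult)
      also have "\<dots> > r * (real (Suc n) * norm T)" using T r by (intro mult_strict_left_mono) auto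
      also have "r * (real (Suc n) * norm T) = 1"
        unfolding r_def using pos by (intro left_inverse) (simp del: of_nat_Suc)
      finally have "cmod (?f (complex_of_real r *\<^sub>C T)) > 1" .
      moreover have "norm (complex_of_real r *\<^sub>C T) = r * norm T"
        using r by (simp add: norm_scaleC)
      then have "norm (complex_of_real r *\<^sub>C T) = inverse (real (Suc n))"
        using pos by (simp add: r_def)
      ultimately show ?thesis using scaleC_closed[OF T(1)] by blast
    qed
    then obtain T where T: "\<And>n. T n \<in> M" "\<And>n. norm (T n) = inverse (real (Suc n))"
        "\<And>n. cmod (?f (T n)) > 1" by metis
    have "(\<lambda>n. norm (T n)) \<longlonglongrightarrow> 0" unfolding T(2) by (rule LIMSEQ_inverse_real_of_nat)
    then have "T \<longlonglongrightarrow> 0" by (simp add: tendsto_norm_zero_iff)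
    then have "(\<lambda>n. blinfun_apply (T n) v) \<longlonglongrightarrow> blinfun_apply 0 v" for v
      by (intro tendsto_intros)
    then have "(\<lambda>n. ?f (T n)) \<longlonglongrightarrow> ?f 0"
      by (intro coefficient_tendsto[where C = 1]) (auto simp: T zero_closed inverse_le_1_iff)
    then have "(\<lambda>n. cmod (?f (T n))) \<longlonglongrightarrow> 0"
      by (auto simp: image_zero dest: tendsto_norm)
    then have "(1::real) \<le> 0"
      by (rule LIMSEQ_le_const) (auto intro!: exI[of _ 0] less_imp_le T(3))
    then show False by simp
  qed
  then show ?thesis using that by blast
qed

end

lemma le_of_powers_le:
  fixes a b C :: real
  assumes "0 \<le> b" and le: "\<And>k. a ^ (2 ^ k) \<le> C * b ^ (2 ^ k)"
  shows "a \<le> b"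
proof (rule ccontr)
  assume "\<not> a \<le> b"
  then have ab: "a > b" by simp
  show False
  proof (cases "b = 0")
    case True
    then show False using le[of 0] ab by simp
  next
    case False
    define q where "q = a / b"
    have q: "q > 1" using ab False assms(1) by (simp add: q_def field_simps)
    obtain k where k: "C < q ^ k" using real_arch_pow[OF q] by blast
    have "q ^ k \<le> q ^ (2 ^ k)" using q by (intro power_increasing) auto
    with k have "C * b ^ (2 ^ k) < q ^ (2 ^ k) * b ^ (2 ^ k)"
      using False assms(1) by (intro mult_strict_right_mono) auto
    also have "\<dots> = a ^ (2 ^ k)" using False by (simp add: q_def power_divide)
    finally show False using le[of k] by simp
  qed
qed

context normal_endomorphism
begin

lemma mat_mult_closed:
  assumes "\<And>i j. i < n \<Longrightarrow> j < n \<Longrightarrow> a i j \<in> M" "\<And>i j. i < n \<Longrightarrow> j < n \<Longrightarrow> b i j \<in> M" "i < n" "j < n"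
  shows "mat_mult n a b i j \<in> M"
  using assms by (auto simp: mat_mult_def intro!: sum_closed compose_closed)

lemma image_mat_mult:
  assumes "i < n"
    and "\<And>i j. i < n \<Longrightarrow> j < n \<Longrightarrow> a i j \<in> M" "\<And>i j. i < n \<Longrightarrow> j < n \<Longrightarrow> b i j \<in> M"
  shows "mat_apply n (\<lambda>i j. \<theta> (mat_mult n a b i j)) x i
    = mat_apply n (mat_mult n (\<lambda>i j. \<theta> (a i j)) (\<lambda>i j. \<theta> (b i j))) x i"
  unfolding mat_apply_def mat_mult_def
  by (intro sum.cong arg_cong2[where f = blinfun_apply] refl)
    (subst image_sum; use assms in \<open>simp add: image_compose compose_closed\<close>)

text \<open>For a unit vector \<open>\<xi>\<close> and self-adjoint \<open>a\<close>, the Cauchy-Schwarz inequality gives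
  \<open>\<bar>\<langle>\<xi>, \<theta>(a) \<xi>\<rangle>\<bar>\<^sup>2 \<le> \<langle>\<xi>, \<theta>(a\<^sup>2) \<xi>\<rangle>\<close>. Iterating from \<open>a = z* z\<close>, the powers
  \<open>\<parallel>\<theta>(z) \<xi>\<parallel>\<close> to the exponent \<open>2 ^ (k + 1)\<close> are at most \<open>C * \<parallel>z\<parallel>\<close> to the same exponent,
  with \<open>C\<close> independent of \<open>k\<close>; roots remove \<open>C\<close>. This uses no functional calculus for
  operator matrices.\<close>

theorem completely_contractive:
  assumes z: "\<And>i j. i < n \<Longrightarrow> j < n \<Longrightarrow> z i j \<in> M"
  shows "matrix_norm n (\<lambda>i j. \<theta> (z i j)) \<le> matrix_norm n z"
proof (rule matrix_norm_leI)
  fix \<xi> :: "nat \<Rightarrow> 'a" assume \<xi>: "tuple_norm n \<xi> \<le> 1"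
  define m where "m = matrix_norm n z"
  define ap where "ap a = mat_apply n (\<lambda>i j. \<theta> (a i j)) \<xi>" for a
  define f where "f a = tuple_inner n \<xi> (ap a)" for a
  \<comment> \<open>The matrix \<open>a k\<close> is \<open>z* z\<close> to the power \<open>2 ^ k\<close>.\<close>
  define a where "a = rec_nat (mat_mult n (mat_adj z) z) (\<lambda>_ b. mat_mult n b b)"
  have a0: "a 0 = mat_mult n (mat_adj z) z" and aS: "a (Suc k) = mat_mult n (a k) (a k)" for k
    by (simp_all add: a_def)
  have z_adj: "mat_adj z i j \<in> M" if "i < n" "j < n" for i j
    using that z by (simp add: mat_adj_def adj_closed)
  have aM: "a k i j \<in> M" if "i < n" "j < n" for k i j
    using that
  proof (induction k arbitrary: i j)
    case 0
    then show ?case unfolding a0 by (intro mat_mult_closed z z_adj)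
  next
    case (Suc k)
    then show ?case unfolding aS by (intro mat_mult_closed) auto
  qed
  have inner_step: "tuple_inner n \<xi> (ap (mat_mult n (mat_adj b) c)) = tuple_inner n (ap b) (ap c)"
    if b: "\<And>i j. i < n \<Longrightarrow> j < n \<Longrightarrow> b i j \<in> M" and c: "\<And>i j. i < n \<Longrightarrow> j < n \<Longrightarrow> c i j \<in> M" for b c
  proof -
    have b': "mat_adj b i j \<in> M" if "i < n" "j < n" for i j
      using that b by (simp add: mat_adj_def adj_closed)
    have "tuple_inner n \<xi> (ap (mat_mult n (mat_adj b) c))
        = tuple_inner n \<xi> (mat_apply n (\<lambda>i j. \<theta> (mat_adj b i j)) (ap c))"
      unfolding tuple_inner_def ap_def using image_mat_mult[OF _ b' c]
      by (intro sum.cong refl) (simp add: mat_apply_mat_mult)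
    also have "\<dots> = tuple_inner n \<xi> (mat_apply n (mat_adj (\<lambda>i j. \<theta> (b i j))) (ap c))"
      unfolding tuple_inner_def mat_apply_def mat_adj_def using b by (simp add: image_adj)
    also have "\<dots> = tuple_inner n (ap b) (ap c)"
      unfolding ap_def by (rule tuple_inner_mat_adj) (use b in \<open>auto intro: clinear image_closed\<close>)
    finally show ?thesis .
  qed
  have a_adj: "mat_adj (a k) i j = a k i j" if "i < n" "j < n" for k i j
    using that
  proof (induction k arbitrary: i j)
    case 0
    show ?case
    proof (rule adj_eqI[of _ "a 0 j i", folded mat_adj_def])
      fix x y
      have "cinner (a 0 i j y) x = (\<Sum>k<n. cinner (z k j y) (z k i x))"
        using 0 z by (simp add: a0 mat_mult_def mat_adj_def blinfun.sum_left cinner.sum_left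
            cinner_adj_left clinear)
      also have "\<dots> = cinner y (a 0 j i x)"
        using 0 z by (simp add: a0 mat_mult_def mat_adj_def blinfun.sum_left cinner.sum_right
            cinner_adj_right clinear)
      finally show "cinner (a 0 i j y) x = cinner y (a 0 j i x)" .
    qed
  next
    case (Suc k)
    show ?case
    proof (rule adj_eqI[of _ "a (Suc k) j i", folded mat_adj_def])
      fix x y
      have sym: "cinner (a k i j y) x = cinner y (a k j i x)" if "i < n" "j < n" for i j x y
        using Suc.IH[OF that] cinner_adj_left[OF clinear[OF aM[OF that(2,1)]], of k y x]
        by (simp add: mat_adj_def)
      have "cinner (a (Suc k) i j y) x = (\<Sum>l<n. cinner (a k l j y) (a k l i x))"
        using Suc.prems by (simp add: aS mat_mult_def blinfun.sum_left cinner.sum_left sym)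
      also have "\<dots> = cinner y (a (Suc k) j i x)"
        using Suc.prems by (simp add: aS mat_mult_def blinfun.sum_left cinner.sum_right sym)
      finally show "cinner (a (Suc k) i j y) x = cinner y (a (Suc k) j i x)" .
    qed
  qed
  have f0: "f (a 0) = complex_of_real ((tuple_norm n (ap z))\<^sup>2)"
    unfolding f_def a0 tuple_inner_self[symmetric] by (rule inner_step) (rule z; assumption)+
  have fS: "f (a (Suc k)) = complex_of_real ((tuple_norm n (ap (a k)))\<^sup>2)" for k
  proof -
    have "mat_mult n (mat_adj (a k)) (a k) i j = a (Suc k) i j" if "i < n" "j < n" for i j
      using that by (simp add: aS mat_mult_def a_adj)
    then have "f (a (Suc k)) = tuple_inner n \<xi> (ap (mat_mult n (mat_adj (a k)) (a k)))"
      unfolding f_def tuple_inner_def ap_def mat_apply_def by (intro sum.cong refl) simp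
    also have "\<dots> = tuple_inner n (ap (a k)) (ap (a k))" by (rule inner_step) (rule aM; assumption)+
    finally show ?thesis by (simp add: tuple_inner_self)
  qed
  have square: "(cmod (f (a k)))\<^sup>2 \<le> cmod (f (a (Suc k)))" for k
  proof -
    have "cmod (f (a k)) \<le> tuple_norm n \<xi> * tuple_norm n (ap (a k))"
      unfolding f_def by (rule cmod_tuple_inner_le)
    also have "\<dots> \<le> 1 * tuple_norm n (ap (a k))" using \<xi> by (intro mult_right_mono) auto
    finally have "(cmod (f (a k)))\<^sup>2 \<le> (tuple_norm n (ap (a k)))\<^sup>2" by (intro power_mono) auto
    then show ?thesis by (simp add: fS norm_power)
  qed
  have powers: "(cmod (f (a 0))) ^ (2 ^ k) \<le> cmod (f (a k))" for k
  proof (induction k)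
    case (Suc k)
    have "cmod (f (a 0)) ^ (2 ^ Suc k) = (cmod (f (a 0)) ^ (2 ^ k))\<^sup>2"
      by (simp add: power_mult[symmetric] mult.commute)
    also have "\<dots> \<le> (cmod (f (a k)))\<^sup>2" by (intro power_mono Suc) auto
    finally show ?case using square[of k] by simp
  qed simp
  have a_norm: "matrix_norm n (a k) \<le> (m\<^sup>2) ^ (2 ^ k)" for k
  proof (induction k)
    case 0
    have "matrix_norm n (mat_adj z) \<le> m" unfolding m_def by (rule matrix_norm_mat_adj) (rule clinear[OF z])
    then show ?case unfolding a0
      using order_trans[OF matrix_norm_mat_mult mult_right_mono[of _ m "matrix_norm n z"]]
      by (simp add: power2_eq_square m_def)
  next
    case (Suc k)
    have "matrix_norm n (a (Suc k)) \<le> matrix_norm n (a k) * matrix_norm n (a k)"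
      unfolding aS by (rule matrix_norm_mat_mult)
    also have "\<dots> \<le> (m\<^sup>2) ^ (2 ^ k) * (m\<^sup>2) ^ (2 ^ k)" by (intro mult_mono Suc) auto
    finally show ?case by (simp add: power_add[symmetric] mult_2)
  qed
  have "\<exists>C\<ge>0. \<forall>T\<in>M. cmod (cinner (\<xi> i) (blinfun_apply (\<theta> T) (\<xi> j))) \<le> C * norm T" for i j
    by (rule coefficient_bounded[of "\<xi> i" "\<xi> j"]) blast
  then obtain C where C: "\<And>i j. C i j \<ge> 0"
    "\<And>i j T. T \<in> M \<Longrightarrow> cmod (cinner (\<xi> i) (blinfun_apply (\<theta> T) (\<xi> j))) \<le> C i j * norm T" by metis
  define D where "D = (\<Sum>i<n. \<Sum>j<n. C i j)"
  have bound: "cmod (f (a k)) \<le> D * (m\<^sup>2) ^ (2 ^ k)" for k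
  proof -
    have "cmod (f (a k)) \<le> (\<Sum>i<n. \<Sum>j<n. cmod (cinner (\<xi> i) (\<theta> (a k i j) (\<xi> j))))"
      unfolding f_def tuple_inner_def ap_def mat_apply_def cinner.sum_right
      by (intro order_trans[OF norm_sum] sum_mono) simp
    also have "\<dots> \<le> (\<Sum>i<n. \<Sum>j<n. C i j * (m\<^sup>2) ^ (2 ^ k))"
      by (intro sum_mono order_trans[OF C(2)] mult_left_mono C(1) aM
          order_trans[OF norm_entry_le_matrix_norm a_norm]) auto
    finally show ?thesis by (simp add: D_def sum_distrib_right)
  qed
  have "cmod (f (a 0)) \<le> m\<^sup>2"
    by (rule le_of_powers_le[where C = D], simp, rule order_trans[OF powers bound])
  then have "(tuple_norm n (ap z))\<^sup>2 \<le> m\<^sup>2" by (simp add: f0 norm_power)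
  then show "tuple_norm n (mat_apply n (\<lambda>i j. \<theta> (z i j)) \<xi>) \<le> matrix_norm n z"
    unfolding m_def ap_def by (rule power2_le_imp_le) simp
qed

corollary contractive: "T \<in> M \<Longrightarrow> norm (\<theta> T) \<le> norm T"
  using completely_contractive[of 1 "\<lambda>_ _. T"] unfolding matrix_norm_one by simp

end


section \<open>Coherent sequences along increasing projections\<close>

definition is_projection :: "('a::complex_hilbert_space \<Rightarrow>\<^sub>L 'a) \<Rightarrow> bool"
  where "is_projection q \<longleftrightarrow> q \<in> clinear_ops \<and> q o\<^sub>L q = q \<and> adj q = q"

lemma projection_idem: "is_projection q \<Longrightarrow> blinfun_apply q (blinfun_apply q v) = blinfun_apply q v"
  unfolding is_projection_def by (metis blinfun_apply_blinfun_compose)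

lemma projection_cinner:
  "is_projection q \<Longrightarrow> cinner (blinfun_apply q v) w = cinner v (blinfun_apply q w)"
  unfolding is_projection_def by (metis cinner_adj_left)

lemma projection_pythagoras:
  assumes q: "is_projection q"
  shows "(norm (v - blinfun_apply q v))\<^sup>2 = (norm v)\<^sup>2 - (norm (blinfun_apply q v))\<^sup>2"
proof -
  have "inner (q v) (q v) = inner v (q v)" "inner (q v) v = inner v (q v)"
    by (simp_all add: inner_eq_Re_cinner projection_cinner[OF q] projection_idem[OF q])
  then show ?thesis by (simp add: power2_norm_eq_inner inner_diff_left inner_diff_right)
qed

lemma projection_norm_le:
  assumes q: "is_projection q"
  shows "norm (blinfun_apply q v) \<le> norm v"
proof (rule power2_le_imp_le)
  have "0 \<le> (norm (v - q v))\<^sup>2" by simp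
  then show "(norm (q v))\<^sup>2 \<le> (norm v)\<^sup>2" unfolding projection_pythagoras[OF q] by simp
qed simp

lemma bounded_pointwise_limit:
  fixes X :: "nat \<Rightarrow> 'a::real_normed_vector \<Rightarrow>\<^sub>L 'b::real_normed_vector"
  assumes bound: "\<And>n. norm (X n) \<le> C"
    and conv: "\<And>v. convergent (\<lambda>n. blinfun_apply (X n) v)"
  obtains S where "\<And>v. (\<lambda>n. blinfun_apply (X n) v) \<longlonglongrightarrow> blinfun_apply S v"
proof -
  define s where "s v = lim (\<lambda>n. X n v)" for v
  have s: "(\<lambda>n. X n v) \<longlonglongrightarrow> s v" for v using conv[of v] by (simp add: s_def convergent_LIMSEQ_iff)
  have "bounded_linear s"
  proof (rule bounded_linear_intro)
    fix x y :: 'a and r :: real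
    have "(\<lambda>n. X n (x + y)) \<longlonglongrightarrow> s x + s y"
      unfolding blinfun.add_right by (intro tendsto_add s)
    then show "s (x + y) = s x + s y" by (rule LIMSEQ_unique[OF s])
    have "(\<lambda>n. X n (r *\<^sub>R x)) \<longlonglongrightarrow> r *\<^sub>R s x"
      unfolding blinfun.scaleR_right by (intro tendsto_intros s)
    then show "s (r *\<^sub>R x) = r *\<^sub>R s x" by (rule LIMSEQ_unique[OF s])
    have "norm (X n x) \<le> norm x * C" for n
      unfolding mult.commute[of "norm x"]
      by (intro order_trans[OF norm_blinfun] mult_right_mono bound) simp
    then show "norm (s x) \<le> norm x * C"
      by (intro LIMSEQ_le_const2[OF tendsto_norm[OF s]]) auto
  qed
  then show thesis using that[of "Blinfun s"] s by (simp add: bounded_linear_Blinfun_apply)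
qed

text \<open>On the range of \<open>P k\<close> the vectors \<open>X n u\<close> form a martingale: \<open>X m u\<close> is the projection of
  \<open>X n u\<close> by \<open>P m\<close>. Their norms increase and are bounded, and by Pythagoras the differences of
  the squared norms control the distances.\<close>

lemma coherent_sequence_strong_limit:
  fixes X :: "nat \<Rightarrow> 'a::complex_hilbert_space \<Rightarrow>\<^sub>L 'a"
  assumes proj: "\<And>n. is_projection (P n)"
    and mono: "\<And>m n. m \<le> n \<Longrightarrow> P n o\<^sub>L P m = P m"
    and one: "\<And>v. (\<lambda>n. blinfun_apply (P n) v) \<longlonglongrightarrow> v"
    and bound: "\<And>n. norm (X n) \<le> C"
    and coherent: "\<And>m n. m \<le> n \<Longrightarrow> P m o\<^sub>L X n o\<^sub>L P m = X m"
  obtains S where "\<And>v. (\<lambda>n. blinfun_apply (X n) v) \<longlonglongrightarrow> blinfun_apply S v"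
proof -
  have C: "C \<ge> 0" using order_trans[OF norm_ge_zero bound[of 0]] .
  have range_Cauchy: "Cauchy (\<lambda>n. X n (P k w))" for k w
  proof -
    define u where "u = P k w"
    have u: "P m u = u" if "k \<le> m" for m
      using arg_cong[OF mono[OF that], of "\<lambda>T. blinfun_apply T w"] by (simp add: u_def)
    have mart: "X m u = P m (X n u)" if "k \<le> m" "m \<le> n" for m n
      using arg_cong[OF coherent[OF that(2)], of "\<lambda>T. blinfun_apply T u"] u[OF that(1)] by simp
    have pyth: "(norm (X n u - X m u))\<^sup>2 = (norm (X n u))\<^sup>2 - (norm (X m u))\<^sup>2"
      if "k \<le> m" "m \<le> n" for m n
      unfolding mart[OF that] by (rule projection_pythagoras[OF proj])
    define b where "b n = (norm (X (n + k) u))\<^sup>2" for n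
    have "incseq b"
    proof (rule incseq_SucI)
      fix n
      show "b n \<le> b (Suc n)"
        using pyth[of "n + k" "Suc n + k"] zero_le_power2[of "norm (X (Suc n + k) u - X (n + k) u)"]
        unfolding b_def by simp
    qed
    moreover have "b n \<le> (C * norm u)\<^sup>2" for n unfolding b_def
      by (intro power_mono order_trans[OF norm_blinfun] mult_right_mono bound) auto
    ultimately have "convergent b"
      by (intro Bseq_mono_convergent BseqI'[where K = "(C * norm u)\<^sup>2"])
        (auto simp: b_def incseq_def)
    then have cb: "Cauchy b" by (rule convergent_Cauchy)
    have "Cauchy (\<lambda>n. X (n + k) u)"
    proof (rule metric_CauchyI)
      fix e :: real assume e: "e > 0"
      then obtain N where N: "\<And>i j. i \<ge> N \<Longrightarrow> j \<ge> N \<Longrightarrow> dist (b i) (b j) < e\<^sup>2"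
        using metric_CauchyD[OF cb, of "e\<^sup>2"] by auto
      have lt: "dist (X (i + k) u) (X (j + k) u) < e" if "i \<ge> N" "j \<ge> N" "i \<le> j" for i j
      proof -
        have "(norm (X (j + k) u - X (i + k) u))\<^sup>2 = b j - b i"
          using pyth[of "i + k" "j + k"] that by (simp add: b_def)
        also have "\<dots> < e\<^sup>2" using N[OF that(1,2)] by (simp add: dist_real_def)
        finally show ?thesis using e
          by (simp add: dist_norm norm_minus_commute power2_less_imp_less)
      qed
      have "dist (X (i + k) u) (X (j + k) u) < e" if "i \<ge> N" "j \<ge> N" for i j
        using lt[OF that] lt[OF that(2,1)] by (cases "i \<le> j") (auto simp: dist_commute)
      then show "\<exists>N. \<forall>i\<ge>N. \<forall>j\<ge>N. dist (X (i + k) u) (X (j + k) u) < e" by blast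
    qed
    then have "convergent (\<lambda>n. X (n + k) u)" by (rule Cauchy_convergent)
    then obtain x where "(\<lambda>n. X (n + k) u) \<longlonglongrightarrow> x" by (auto simp: convergent_def)
    then have "convergent (\<lambda>n. X n u)"
      using LIMSEQ_offset[of "\<lambda>n. X n u" k x] by (auto simp: convergent_def)
    then show ?thesis unfolding u_def by (rule convergent_Cauchy)
  qed
  have "Cauchy (\<lambda>n. X n v)" for v
  proof (rule metric_CauchyI)
    fix e :: real assume e: "e > 0"
    define d where "d = e / (3 * (C + 1))"
    have d: "d > 0" "C * d \<le> e / 3" using e C by (auto simp: d_def field_simps)
    obtain k where k: "dist (P k v) v < d"
      using metric_LIMSEQ_D[OF one[of v] d(1)] by blast
    obtain N where N: "\<And>i j. i \<ge> N \<Longrightarrow> j \<ge> N \<Longrightarrow> dist (X i (P k v)) (X j (P k v)) < e / 3"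
      using metric_CauchyD[OF range_Cauchy[of k v], of "e / 3"] e by auto
    have near: "dist (X i v) (X i (P k v)) \<le> e / 3" for i
    proof -
      have "dist (X i v) (X i (P k v)) = norm (X i (v - P k v))"
        by (simp add: dist_norm blinfun.diff_right)
      also have "\<dots> \<le> C * norm (v - P k v)"
        by (intro order_trans[OF norm_blinfun] mult_right_mono bound) auto
      also have "\<dots> \<le> C * d" using k C by (intro mult_left_mono) (auto simp: dist_norm norm_minus_commute)
      finally show ?thesis using d(2) by linarith
    qed
    have "dist (X i v) (X j v) < e" if "i \<ge> N" "j \<ge> N" for i j
    proof -
      have "dist (X i v) (X j v) \<le> dist (X i v) (X i (P k v))
          + dist (X i (P k v)) (X j (P k v)) + dist (X j (P k v)) (X j v)"
        using dist_triangle[of "X i v" "X j v" "X i (P k v)"]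
          dist_triangle[of "X i (P k v)" "X j v" "X j (P k v)"] by linarith
      then show ?thesis using near[of i] near[of j] N[OF that] by (simp add: dist_commute)
    qed
    then show "\<exists>N. \<forall>i\<ge>N. \<forall>j\<ge>N. dist (X i v) (X j v) < e" by blast
  qed
  then have conv: "convergent (\<lambda>n. X n v)" for v by (rule Cauchy_convergent)
  show thesis by (rule bounded_pointwise_limit[of X C, OF bound conv]) (rule that)
qed


section \<open>Simultaneous recurrence on the circle\<close>

lemma simultaneous_recurrence:
  fixes L :: "complex set"
  assumes L: "finite L" and unit: "\<And>l. l \<in> L \<Longrightarrow> cmod l = 1"
  obtains m :: "nat \<Rightarrow> nat" where "filterlim m at_top sequentially"
    "\<And>l. l \<in> L \<Longrightarrow> (\<lambda>k. l ^ m k) \<longlonglongrightarrow> 1"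
proof -
  obtain N and f :: "nat \<Rightarrow> complex" where f: "L = f ` {i. i < N}"
    using finite_imp_nat_seg_image_inj_on[OF L] by blast
  have "\<exists>t. f i = cis t" if "i < N" for i
  proof
    show "f i = cis (Arg (f i))"
      using unit[of "f i"] that by (simp add: f cis_conv_exp complex_norm_eq_1_exp_eq)
  qed
  then obtain t where t: "\<And>i. i < N \<Longrightarrow> f i = cis (t i)" by metis
  \<comment> \<open>Approximating the multiples by \<open>k + 1\<close> of the angles forces the exponents to grow.\<close>
  have "\<exists>q p. 0 < q \<and> (\<forall>i<N. \<bar>of_int q * (real (Suc k) * (t i / (2 * pi))) - of_int (p i)\<bar> < 1 / real (Suc k))"
    for k
    by (rule Dirichlet_approx_simult[of "Suc k" N "\<lambda>i. real (Suc k) * (t i / (2 * pi))"]) auto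
  then obtain q :: "nat \<Rightarrow> int" and p :: "nat \<Rightarrow> nat \<Rightarrow> int" where q: "\<And>k. 0 < q k"
    and qp: "\<And>k i. i < N \<Longrightarrow> \<bar>of_int (q k) * (real (Suc k) * (t i / (2 * pi))) - of_int (p k i)\<bar> < 1 / real (Suc k)"
    by metis
  define m where "m k = nat (q k) * Suc k" for k
  have "k \<le> m k" for k
    using q[of k] unfolding m_def by (cases "nat (q k)") auto
  then have "filterlim m at_top sequentially"
    by (intro filterlim_at_top_mono[OF filterlim_ident]) auto
  moreover have "(\<lambda>k. l ^ m k) \<longlonglongrightarrow> 1" if l: "l \<in> L" for l
  proof -
    obtain i where i: "i < N" "l = f i" using l f by auto
    define d where "d k = of_int (q k) * (real (Suc k) * (t i / (2 * pi))) - of_int (p k i)" for k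
    have "\<bar>d k\<bar> < inverse (real (Suc k))" for k
      using qp[OF i(1)] by (simp add: d_def inverse_eq_divide)
    then have "d \<longlonglongrightarrow> 0"
      by (intro Lim_null_comparison[OF _ LIMSEQ_inverse_real_of_nat] always_eventually allI)
        (auto intro: less_imp_le)
    then have "(\<lambda>k. cis (2 * pi * d k)) \<longlonglongrightarrow> cis (2 * pi * 0)" by (intro tendsto_intros)
    moreover have "l ^ m k = cis (2 * pi * d k)" for k
    proof -
      have "real (m k) * t i = 2 * pi * of_int (p k i) + 2 * pi * d k"
        using q[of k] by (simp add: d_def m_def field_simps)
      then have "cis (real (m k) * t i) = cis (2 * pi * of_int (p k i)) * cis (2 * pi * d k)"
        by (simp only: cis_mult)
      moreover have "l ^ m k = cis (real (m k) * t i)"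
        by (simp only: i(2) t[OF i(1)] Complex.DeMoivre)
      ultimately show ?thesis by (simp add: cis_multiple_2pi)
    qed
    ultimately show ?thesis by simp
  qed
  ultimately show thesis by (rule that)
qed


section \<open>The minimal dilation of a unital map\<close>

locale unital_dilation =
  fixes V :: "'h::complex_hilbert_space \<Rightarrow>\<^sub>L 'k::complex_hilbert_space"
    and A :: "('h \<Rightarrow>\<^sub>L 'h) set" and \<tau> :: "('h \<Rightarrow>\<^sub>L 'h) \<Rightarrow> ('h \<Rightarrow>\<^sub>L 'h)"
    and B :: "('k \<Rightarrow>\<^sub>L 'k) set" and \<theta> :: "('k \<Rightarrow>\<^sub>L 'k) \<Rightarrow> ('k \<Rightarrow>\<^sub>L 'k)"
  assumes dilation: "minimal_dilation_unital V A \<tau> B \<theta>"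
    and unital: "\<tau> id_blinfun = id_blinfun"

sublocale unital_dilation \<subseteq> normal_endomorphism B \<theta>
  using dilation by unfold_locales (auto simp: minimal_dilation_unital_def)

context unital_dilation
begin

lemma V_clinear: "V \<in> clinear_ops" and V_isometry: "norm (blinfun_apply V h) = norm h"
  using dilation by (auto simp: minimal_dilation_unital_def isometric_embedding_def)

lemma adj_V_V [simp]: "blinfun_apply (adj V) (blinfun_apply V h) = h"
  by (rule cinner_eqI)
    (simp add: cinner_adj_left V_clinear isometry_preserves_cinner V_isometry)

lemma compression_embed_op: "compression V (embed_op V x) = x"
  by (rule blinfun_eqI) (simp add: compression_def embed_op_def)

lemma embed_op_inject: "embed_op V x = embed_op V y \<Longrightarrow> x = y"
  by (metis compression_embed_op)

lemma embed_op_id: "embed_op V id_blinfun = range_proj V"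
  by (rule blinfun_eqI) (simp add: embed_op_def range_proj_def)

lemma embed_op_scaleC: "embed_op V (c *\<^sub>C x) = c *\<^sub>C embed_op V x"
  by (rule blinfun_eqI) (simp add: embed_op_def scaleC_blinfun_apply clinear_opsD[OF V_clinear])

lemma range_proj_projection: "is_projection (range_proj V)"
  unfolding is_projection_def range_proj_def
  by (auto intro!: blinfun_eqI clinear_compose V_clinear adj_clinear
      simp: adj_compose V_clinear adj_clinear adj_adj)

lemma norm_adj_V_le: "norm (blinfun_apply (adj V) v) \<le> norm v"
proof -
  have "norm (adj V v) = norm (range_proj V v)" by (simp add: range_proj_def V_isometry)
  then show ?thesis using projection_norm_le[OF range_proj_projection] by simp
qed

lemma range_proj_embed_op:
  "range_proj V o\<^sub>L embed_op V x = embed_op V x" "embed_op V x o\<^sub>L range_proj V = embed_op V x"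
  by (rule blinfun_eqI; simp add: range_proj_def embed_op_def)+

lemma embed_op_closed: "x \<in> A \<Longrightarrow> embed_op V x \<in> B"
proof -
  assume x: "x \<in> A"
  have "B = generated_von_neumann_algebra {(\<theta> ^^ n) (embed_op V x) | n x. x \<in> A}"
    using dilation by (simp add: minimal_dilation_unital_def)
  moreover have "embed_op V x \<in> {(\<theta> ^^ n) (embed_op V x) | n x. x \<in> A}"
    using x by (intro CollectI exI[of _ 0] exI[of _ x]) simp
  ultimately show ?thesis unfolding generated_von_neumann_algebra_def by blast
qed

lemma compression_closed:
  assumes "b \<in> B"
  shows "compression V b \<in> A"
proof -
  have "embed_op V ` A = (\<lambda>b. range_proj V o\<^sub>L b o\<^sub>L range_proj V) ` B"
    using dilation by (simp add: minimal_dilation_unital_def)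
  then obtain x where x: "x \<in> A" "embed_op V x = range_proj V o\<^sub>L b o\<^sub>L range_proj V"
    using assms by (metis (mono_tags, lifting) image_iff)
  then have "embed_op V x = embed_op V (compression V b)" by (simp add: embed_op_compression)
  with x(1) show ?thesis using embed_op_inject by metis
qed

lemma range_proj_closed: "range_proj V \<in> B"
proof -
  have "id_blinfun \<in> B" using algebra by (simp add: von_neumann_algebra_def)
  from embed_op_closed[OF compression_closed[OF this]] show ?thesis
    using range_proj_projection
    by (simp add: embed_op_compression is_projection_def blinfun_compose_id)
qed

lemma id_closed: "id_blinfun \<in> A"
  using compression_closed[OF range_proj_closed] by (metis compression_embed_op embed_op_id)

lemma dilation_power:
  "x \<in> A \<Longrightarrow> embed_op V ((\<tau> ^^ n) x) = range_proj V o\<^sub>L (\<theta> ^^ n) (embed_op V x) o\<^sub>L range_proj V"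
  using dilation by (simp add: minimal_dilation_unital_def)

lemma dilation_once:
  "x \<in> A \<Longrightarrow> embed_op V (\<tau> x) = range_proj V o\<^sub>L \<theta> (embed_op V x) o\<^sub>L range_proj V"
  using dilation_power[of x 1] by simp

lemma funpow_closed: "T \<in> B \<Longrightarrow> (\<theta> ^^ n) T \<in> B"
  and funpow_compose: "S \<in> B \<Longrightarrow> T \<in> B \<Longrightarrow> (\<theta> ^^ n) (S o\<^sub>L T) = (\<theta> ^^ n) S o\<^sub>L (\<theta> ^^ n) T"
  and funpow_scaleC: "T \<in> B \<Longrightarrow> (\<theta> ^^ n) (c *\<^sub>C T) = c *\<^sub>C (\<theta> ^^ n) T"
  and funpow_adj: "T \<in> B \<Longrightarrow> (\<theta> ^^ n) (adj T) = adj ((\<theta> ^^ n) T)"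
  and funpow_image_add: "S \<in> B \<Longrightarrow> T \<in> B \<Longrightarrow> (\<theta> ^^ n) (S + T) = (\<theta> ^^ n) S + (\<theta> ^^ n) T"
  and funpow_zero: "(\<theta> ^^ n) 0 = 0"
  and funpow_contractive: "T \<in> B \<Longrightarrow> norm ((\<theta> ^^ n) T) \<le> norm T"
  using normal_endomorphism.image_closed[OF funpow_endomorphism]
    normal_endomorphism.image_compose[OF funpow_endomorphism]
    normal_endomorphism.image_scaleC[OF funpow_endomorphism]
    normal_endomorphism.image_adj[OF funpow_endomorphism]
    normal_endomorphism.image_add[OF funpow_endomorphism]
    normal_endomorphism.image_zero[OF funpow_endomorphism]
    normal_endomorphism.contractive[OF funpow_endomorphism]
  by auto

definition P :: "nat \<Rightarrow> 'k \<Rightarrow>\<^sub>L 'k"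
  where "P n = (\<theta> ^^ n) (range_proj V)"

lemma P_projection: "is_projection (P n)"
  using range_proj_projection funpow_closed[OF range_proj_closed, of n]
    funpow_compose[OF range_proj_closed range_proj_closed, of n] funpow_adj[OF range_proj_closed, of n]
  by (simp add: is_projection_def P_def clinear)

text \<open>Unitality of \<open>\<tau>\<close> says \<open>p \<theta>(p) p = p\<close>, so the projection \<open>\<theta>(p)\<close> preserves the norm of
  vectors in the range of \<open>p\<close> and hence fixes them.\<close>

lemma P_one_range_proj: "P 1 o\<^sub>L range_proj V = range_proj V"
proof (rule blinfun_eqI)
  fix v
  define w where "w = range_proj V v"
  have w: "range_proj V w = w" using projection_idem[OF range_proj_projection] by (simp add: w_def)
  have "range_proj V o\<^sub>L P 1 o\<^sub>L range_proj V = range_proj V"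
    using dilation_once[OF id_closed] by (simp add: unital embed_op_id P_def)
  then have "range_proj V (P 1 w) = w"
    unfolding w_def by (metis blinfun_apply_blinfun_compose)
  then have "cinner (P 1 w) (P 1 w) = cinner w w"
    by (metis w projection_cinner[OF range_proj_projection] projection_cinner[OF P_projection]
        projection_idem[OF P_projection])
  then have "(norm (P 1 w))\<^sup>2 = (norm w)\<^sup>2" unfolding cinner_self of_real_eq_iff .
  then have "P 1 w = w" using projection_pythagoras[OF P_projection, of w 1] by simp
  then show "blinfun_apply (P 1 o\<^sub>L range_proj V) v = blinfun_apply (range_proj V) v"
    by (simp add: w_def)
qed

lemma P_mono:
  assumes "m \<le> n"
  shows "P n o\<^sub>L P m = P m"
  using assms
proof (induction n rule: dec_induct)
  case base
  show ?case using P_projection[of m] by (simp add: is_projection_def)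
next
  case (step n)
  have "P (Suc n) o\<^sub>L P n = P n"
  proof -
    have "(\<theta> ^^ n) (P 1 o\<^sub>L range_proj V) = (\<theta> ^^ n) (P 1) o\<^sub>L P n"
      unfolding P_def by (intro funpow_compose funpow_closed range_proj_closed)
    moreover have "(\<theta> ^^ n) (P 1) = P (Suc n)" by (simp add: P_def funpow_swap1)
    ultimately show ?thesis unfolding P_one_range_proj by (simp add: P_def)
  qed
  then have "P (Suc n) o\<^sub>L (P n o\<^sub>L P m) = P n o\<^sub>L P m"
    by (simp add: blinfun_compose_assoc[symmetric])
  then show ?case by (simp add: step.IH)
qed

lemma P_mono_right: "m \<le> n \<Longrightarrow> P m o\<^sub>L P n = P m"
  using arg_cong[OF P_mono, of m n adj] P_projection[of m] P_projection[of n]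
  by (simp add: adj_compose is_projection_def)

lemma P_dilation_word:
  assumes "\<forall>i\<in>{1..n}. x i \<in> A"
  shows "P n (dilation_word V \<theta> x n h) = dilation_word V \<theta> x n h"
proof (cases n)
  case 0
  then show ?thesis by (simp add: P_def range_proj_def)
next
  case (Suc m)
  have "P (Suc m) o\<^sub>L (\<theta> ^^ Suc m) (embed_op V (x (Suc m))) = (\<theta> ^^ Suc m) (embed_op V (x (Suc m)))"
    unfolding P_def using assms Suc
    by (subst funpow_compose[symmetric]) (auto intro: range_proj_closed embed_op_closed simp: range_proj_embed_op)
  then show ?thesis unfolding Suc dilation_word.simps by (metis blinfun_apply_blinfun_compose)
qed

text \<open>By minimality the dilation words span a dense subspace, and each word is fixed by \<open>P n\<close> for all
  large \<open>n\<close>.\<close>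

lemma P_tendsto_id: "(\<lambda>n. blinfun_apply (P n) v) \<longlonglongrightarrow> v"
proof (rule metric_LIMSEQ_I)
  fix e :: real assume e: "e > 0"
  define W where "W = {dilation_word V \<theta> x n h | x n h. \<forall>i\<in>{1..n}. x i \<in> A}"
  have "v \<in> closure (cspan W)" using dilation by (simp add: W_def minimal_dilation_unital_def)
  then obtain w where w: "w \<in> cspan W" "dist w v < e / 2"
    using e closure_approachable[of v "cspan W"] by (metis half_gt_zero)
  have "\<exists>m. \<forall>n\<ge>m. P n w = w" using w(1)
  proof (induction rule: complex_vector.span_induct_alt)
    case base
    show ?case by simp
  next
    case (step c x y)
    obtain m x' h where x: "x = dilation_word V \<theta> x' m h" "\<forall>i\<in>{1..m}. x' i \<in> A"
      using step.hyps by (auto simp: W_def)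
    obtain m' where m': "\<forall>n\<ge>m'. P n y = y" using step.IH by blast
    have "P n x = x" if "m \<le> n" for n
      using arg_cong[OF P_mono[OF that], of "\<lambda>T. blinfun_apply T x"] P_dilation_word[OF x(2), of h]
      by (simp add: x(1))
    moreover have "P n \<in> clinear_ops" for n using P_projection[of n] by (simp add: is_projection_def)
    ultimately show ?case using m'
      by (intro exI[of _ "max m m'"]) (simp add: blinfun.add_right clinear_opsD)
  qed
  then obtain m where m: "\<forall>n\<ge>m. P n w = w" by blast
  have "dist (P n v) v < e" if "n \<ge> m" for n
  proof -
    have "dist (P n v) v \<le> dist (P n v) (P n w) + dist w v"
      using m that dist_triangle[of "P n v" v "P n w"] by simp
    also have "dist (P n v) (P n w) \<le> dist v w"
      using projection_norm_le[OF P_projection, of n "v - w"]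
      by (simp add: dist_norm blinfun.diff_right)
    finally show ?thesis using w(2) by (simp add: dist_commute)
  qed
  then show "\<exists>m. \<forall>n\<ge>m. dist (P n v) v < e" by blast
qed

lemma compression_eigen:
  assumes y: "y \<in> peripheral_eigenspace B \<theta> l"
  shows "compression V y \<in> peripheral_eigenspace A \<tau> l"
proof -
  let ?p = "range_proj V"
  have yB: "y \<in> B" and \<theta>y: "\<theta> y = l *\<^sub>C y" using y by (auto simp: peripheral_eigenspace_def)
  have P1: "P 1 = \<theta> ?p" by (simp add: P_def)
  have "?p o\<^sub>L P 1 = ?p" using P_mono_right[of 0 1] by (simp add: P_def)
  have "embed_op V (\<tau> (compression V y)) = ?p o\<^sub>L \<theta> (?p o\<^sub>L y o\<^sub>L ?p) o\<^sub>L ?p"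
    using dilation_once[OF compression_closed[OF yB]] by (simp add: embed_op_compression)
  also have "\<theta> (?p o\<^sub>L y o\<^sub>L ?p) = P 1 o\<^sub>L \<theta> y o\<^sub>L P 1"
    unfolding P1 by (simp add: image_compose compose_closed range_proj_closed yB)
  also have "?p o\<^sub>L (P 1 o\<^sub>L \<theta> y o\<^sub>L P 1) o\<^sub>L ?p = (?p o\<^sub>L P 1) o\<^sub>L \<theta> y o\<^sub>L (P 1 o\<^sub>L ?p)"
    by (simp add: blinfun_compose_assoc)
  also have "\<dots> = ?p o\<^sub>L \<theta> y o\<^sub>L ?p"
    by (simp only: P_one_range_proj \<open>?p o\<^sub>L P 1 = ?p\<close>)
  also have "\<dots> = l *\<^sub>C embed_op V (compression V y)"
    by (simp add: \<theta>y embed_op_compression compose_scaleC_left compose_scaleC_right clinear range_proj_closed)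
  finally have "embed_op V (\<tau> (compression V y)) = embed_op V (l *\<^sub>C compression V y)"
    by (simp add: embed_op_scaleC)
  then show ?thesis
    using embed_op_inject compression_closed[OF yB] by (simp add: peripheral_eigenspace_def)
qed

lemma A_scaleC_closed: "x \<in> A \<Longrightarrow> c *\<^sub>C x \<in> A"
  using compression_closed[OF scaleC_closed[OF embed_op_closed], of x c]
  by (metis compression_embed_op embed_op_scaleC)

lemma eigen_power:
  assumes x: "x \<in> peripheral_eigenspace A \<tau> l"
  shows "(\<tau> ^^ n) x = l ^ n *\<^sub>C x"
proof (induction n)
  case (Suc n)
  have xA: "x \<in> A" and \<tau>x: "\<tau> x = l *\<^sub>C x" using x by (auto simp: peripheral_eigenspace_def)
  have "embed_op V (\<tau> (c *\<^sub>C x)) = embed_op V (c *\<^sub>C \<tau> x)" for c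
    by (simp add: dilation_once xA A_scaleC_closed embed_op_scaleC image_scaleC
        embed_op_closed compose_scaleC_left compose_scaleC_right clinear range_proj_closed)
  then have "\<tau> (c *\<^sub>C x) = c *\<^sub>C \<tau> x" for c by (rule embed_op_inject)
  then show ?case by (simp add: Suc \<tau>x mult.commute)
qed simp

text \<open>The lift of an eigenvector \<open>x\<close> is the strong limit of \<open>l\<^sup>-\<^sup>n \<theta>\<^sup>n(x)\<close>. The sequence is coherent
  along \<open>P n\<close> because \<open>\<tau>\<^sup>n(x) = l\<^sup>n x\<close>, and normality of \<open>\<theta>\<close> makes its limit an eigenvector.\<close>

lemma eigen_lift:
  assumes x: "x \<in> peripheral_eigenspace A \<tau> l" and l: "cmod l = 1"
  obtains y where "y \<in> peripheral_eigenspace B \<theta> l" "compression V y = x"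
proof -
  define e where "e = embed_op V x"
  have xA: "x \<in> A" using x by (simp add: peripheral_eigenspace_def)
  have eB: "e \<in> B" unfolding e_def by (rule embed_op_closed[OF xA])
  define X where "X n = cnj l ^ n *\<^sub>C (\<theta> ^^ n) e" for n
  have ll: "cnj l * l = 1" using l by (metis complex_norm_square mult.commute of_real_1 power_one)
  have XB: "X n \<in> B" for n unfolding X_def by (intro scaleC_closed funpow_closed eB)
  have bound: "norm (X n) \<le> norm e" for n
    unfolding X_def using funpow_contractive[OF eB, of n] by (simp add: norm_scaleC norm_power l)
  have coherent: "P m o\<^sub>L X n o\<^sub>L P m = X m" if mn: "m \<le> n" for m n
  proof -
    obtain k where n: "n = m + k" using le_Suc_ex[OF mn] by blast
    have "(\<theta> ^^ n) e = (\<theta> ^^ m) ((\<theta> ^^ k) e)" by (simp add: n Nat.funpow_add)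
    then have "P m o\<^sub>L (\<theta> ^^ n) e o\<^sub>L P m = (\<theta> ^^ m) (range_proj V o\<^sub>L (\<theta> ^^ k) e o\<^sub>L range_proj V)"
      by (simp add: P_def funpow_compose compose_closed funpow_closed range_proj_closed eB)
    also have "range_proj V o\<^sub>L (\<theta> ^^ k) e o\<^sub>L range_proj V = l ^ k *\<^sub>C e"
      unfolding e_def by (simp add: dilation_power[OF xA, symmetric] eigen_power[OF x] embed_op_scaleC)
    finally have "P m o\<^sub>L X n o\<^sub>L P m = (cnj l ^ n * l ^ k) *\<^sub>C (\<theta> ^^ m) e"
      by (simp add: X_def compose_scaleC_left compose_scaleC_right funpow_scaleC eB clinear P_def
          funpow_closed range_proj_closed)
    also have "cnj l ^ n * l ^ k = cnj l ^ m"
      by (simp add: n power_add mult.assoc power_mult_distrib[symmetric] ll)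
    finally show ?thesis by (simp add: X_def)
  qed
  obtain S where S: "\<And>v. (\<lambda>n. blinfun_apply (X n) v) \<longlonglongrightarrow> blinfun_apply S v"
    using coherent_sequence_strong_limit[OF P_projection P_mono P_tendsto_id bound coherent] by blast
  have SB: "S \<in> B" by (rule von_neumann_algebra_strong_limit[OF algebra XB S])
  have "\<theta> S = l *\<^sub>C S"
  proof (rule blinfun_eqI, rule cinner_eqI_right)
    fix \<eta> \<xi>
    have "\<theta> (X n) = l *\<^sub>C X (Suc n)" for n
      by (simp add: X_def image_scaleC funpow_closed eB mult.assoc[symmetric] mult.commute[of l] ll)
    then have "(\<lambda>n. cinner \<xi> (\<theta> (X n) \<eta>)) \<longlonglongrightarrow> l * cinner \<xi> (S \<eta>)"
      by (simp add: scaleC_blinfun_apply cinner_scaleC_right)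
        (intro tendsto_intros cinner.tendsto LIMSEQ_Suc[OF S])
    moreover have "(\<lambda>n. cinner \<xi> (\<theta> (X n) \<eta>)) \<longlonglongrightarrow> cinner \<xi> (\<theta> S \<eta>)"
      by (rule coefficient_tendsto[OF XB SB bound S])
    ultimately show "cinner \<xi> (\<theta> S \<eta>) = cinner \<xi> ((l *\<^sub>C S) \<eta>)"
      using LIMSEQ_unique by (simp add: scaleC_blinfun_apply cinner_scaleC_right) blast
  qed
  moreover have "compression V S = x"
  proof (rule blinfun_eqI)
    fix h
    have "embed_op V (compression V (X n)) = embed_op V x" for n
      using coherent[of 0 n] by (simp add: embed_op_compression P_def X_def e_def)
    then have X0: "compression V (X n) = x" for n by (rule embed_op_inject)
    have "adj V (X n (V h)) = x h" for n
      using arg_cong[OF X0[of n], of "\<lambda>T. blinfun_apply T h"] by (simp add: compression_def)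
    moreover have "(\<lambda>n. adj V (X n (V h))) \<longlonglongrightarrow> adj V (S (V h))" by (intro tendsto_intros S)
    ultimately show "blinfun_apply (compression V S) h = blinfun_apply x h"
      by (simp add: compression_def LIMSEQ_const_iff)
  qed
  ultimately show thesis using that SB by (simp add: peripheral_eigenspace_def)
qed

text \<open>The set of frequencies \<open>L\<close> depends on \<open>z\<close> only and is fixed before the exponents \<open>m\<close>, so
  that the finitely many entries of a matrix can share one recurrent sequence.\<close>

lemma peripheral_span_recurrent:
  assumes "z \<in> cspan (\<Union>l\<in>{l. cmod l = 1}. peripheral_eigenspace B \<theta> l)"
  shows "z \<in> B \<and> (\<exists>L. finite L \<and> L \<subseteq> {l. cmod l = 1} \<and>
    (\<forall>m. (\<forall>l\<in>L. (\<lambda>k. l ^ m k) \<longlonglongrightarrow> 1) \<longrightarrow> (\<lambda>k. (\<theta> ^^ m k) z) \<longlonglongrightarrow> z))"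
  using assms
proof (induction rule: complex_vector.span_induct_alt)
  case base
  show ?case by (auto simp: zero_closed funpow_zero intro!: exI[of _ "{}"])
next
  case (step c x y)
  obtain l where l: "cmod l = 1" and x: "x \<in> B" "\<theta> x = l *\<^sub>C x"
    using step.hyps by (auto simp: peripheral_eigenspace_def)
  obtain L where y: "y \<in> B" and L: "finite L" "L \<subseteq> {l. cmod l = 1}"
    "\<And>m. (\<forall>l\<in>L. (\<lambda>k. l ^ m k) \<longlonglongrightarrow> 1) \<Longrightarrow> (\<lambda>k. (\<theta> ^^ m k) y) \<longlonglongrightarrow> y"
    using step.IH by blast
  have xn: "(\<theta> ^^ n) x = l ^ n *\<^sub>C x" for n
    by (induction n) (simp_all add: image_scaleC x mult.commute)
  have "(\<lambda>k. (\<theta> ^^ m k) (c *\<^sub>C x + y)) \<longlonglongrightarrow> c *\<^sub>C x + y"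
    if m: "\<forall>l\<in>insert l L. (\<lambda>k. l ^ m k) \<longlonglongrightarrow> 1" for m
  proof -
    have "(\<lambda>k. c *\<^sub>C (l ^ m k *\<^sub>C x) + (\<theta> ^^ m k) y) \<longlonglongrightarrow> c *\<^sub>C (1 *\<^sub>C x) + y"
      using m by (intro tendsto_add scaleC.tendsto tendsto_const L(3)) auto
    then show ?thesis by (simp add: funpow_image_add funpow_scaleC xn x y scaleC_closed)
  qed
  then show ?case
    using x y l L by (intro conjI exI[of _ "insert l L"]) (auto intro: add_closed scaleC_closed)
qed

lemma matrix_norm_compression_le: "matrix_norm n (\<lambda>i j. compression V (z i j)) \<le> matrix_norm n z"
proof (rule matrix_norm_leI)
  fix x :: "nat \<Rightarrow> 'h" assume x: "tuple_norm n x \<le> 1"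
  have "tuple_norm n (mat_apply n (\<lambda>i j. compression V (z i j)) x)
      = tuple_norm n (\<lambda>i. adj V (mat_apply n z (\<lambda>j. V (x j)) i))"
    by (intro tuple_norm_cong) (simp add: mat_apply_def compression_def blinfun.sum_right)
  also have "\<dots> \<le> tuple_norm n (mat_apply n z (\<lambda>j. V (x j)))"
    by (intro tuple_norm_mono norm_adj_V_le)
  also have "\<dots> \<le> matrix_norm n z"
    using x tuple_norm_cong[of n "\<lambda>j. V (x j)" x]
    by (intro tuple_norm_mat_apply_le_matrix_norm1) (simp add: V_isometry tuple_norm_def)
  finally show "tuple_norm n (mat_apply n (\<lambda>i j. compression V (z i j)) x) \<le> matrix_norm n z" .
qed

lemma matrix_norm_embed_op_le: "matrix_norm n (\<lambda>i j. embed_op V (x i j)) \<le> matrix_norm n x"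
proof (rule matrix_norm_leI)
  fix v :: "nat \<Rightarrow> 'k" assume v: "tuple_norm n v \<le> 1"
  have "tuple_norm n (mat_apply n (\<lambda>i j. embed_op V (x i j)) v)
      = tuple_norm n (mat_apply n x (\<lambda>j. adj V (v j)))"
    unfolding tuple_norm_def
    by (simp add: mat_apply_def embed_op_def V_isometry flip: blinfun.sum_right)
  also have "\<dots> \<le> matrix_norm n x"
    by (intro tuple_norm_mat_apply_le_matrix_norm1 order_trans[OF tuple_norm_mono v] norm_adj_V_le)
  finally show "tuple_norm n (mat_apply n (\<lambda>i j. embed_op V (x i j)) v) \<le> matrix_norm n x" .
qed

text \<open>Along a recurrent sequence of exponents \<open>m\<close>, the operators \<open>\<theta>\<^sup>m(p z p) = P m \<theta>\<^sup>m(z) P m\<close>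
  converge strongly to \<open>z\<close>, while \<open>\<theta>\<^sup>m\<close> cannot increase the norm of \<open>p z p\<close>.\<close>

theorem matrix_norm_compression:
  assumes z: "\<And>i j. i < n \<Longrightarrow> j < n \<Longrightarrow>
    z i j \<in> cspan (\<Union>l\<in>{l. cmod l = 1}. peripheral_eigenspace B \<theta> l)"
  shows "matrix_norm n (\<lambda>i j. compression V (z i j)) = matrix_norm n z"
proof (rule antisym[OF matrix_norm_compression_le], rule matrix_norm_leI)
  fix \<xi> :: "nat \<Rightarrow> 'k" assume \<xi>: "tuple_norm n \<xi> \<le> 1"
  let ?c = "matrix_norm n (\<lambda>i j. compression V (z i j))"
  have zB: "z i j \<in> B" if "i < n" "j < n" for i j
    using peripheral_span_recurrent[OF z[OF that]] by blast
  have "\<exists>L. i < n \<longrightarrow> j < n \<longrightarrow> finite L \<and> L \<subseteq> {l. cmod l = 1} \<and>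
      (\<forall>m. (\<forall>l\<in>L. (\<lambda>k. l ^ m k) \<longlonglongrightarrow> 1) \<longrightarrow> (\<lambda>k. (\<theta> ^^ m k) (z i j)) \<longlonglongrightarrow> z i j)" for i j
  proof (cases "i < n \<and> j < n")
    case True
    then have "z i j \<in> cspan (\<Union>l\<in>{l. cmod l = 1}. peripheral_eigenspace B \<theta> l)" by (intro z) auto
    from conjunct2[OF peripheral_span_recurrent[OF this]] show ?thesis
      by (elim exE) (intro exI impI)
  qed auto
  then obtain L where L: "\<And>i j. i < n \<Longrightarrow> j < n \<Longrightarrow> finite (L i j) \<and> L i j \<subseteq> {l. cmod l = 1} \<and>
      (\<forall>m. (\<forall>l\<in>L i j. (\<lambda>k. l ^ m k) \<longlonglongrightarrow> 1) \<longrightarrow> (\<lambda>k. (\<theta> ^^ m k) (z i j)) \<longlonglongrightarrow> z i j)"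
    by metis
  obtain m where m: "filterlim m at_top sequentially"
      "\<And>l. l \<in> (\<Union>i<n. \<Union>j<n. L i j) \<Longrightarrow> (\<lambda>k. l ^ m k) \<longlonglongrightarrow> 1"
    by (rule simultaneous_recurrence[of "\<Union>i<n. \<Union>j<n. L i j"]) (use L in auto)
  have rec: "(\<lambda>k. (\<theta> ^^ m k) (z i j)) \<longlonglongrightarrow> z i j" if "i < n" "j < n" for i j
  proof -
    have "\<forall>l\<in>L i j. (\<lambda>k. l ^ m k) \<longlonglongrightarrow> 1" using m(2) that by blast
    then show ?thesis using L[OF that] by (elim conjE) (drule spec, erule mp)
  qed
  have Pm: "(\<lambda>k. P (m k) v) \<longlonglongrightarrow> v" for v
    using filterlim_compose[OF P_tendsto_id m(1)] .
  define w where "w k i j = (\<theta> ^^ m k) (embed_op V (compression V (z i j)))" for k i j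
  have w: "w k i j = P (m k) o\<^sub>L (\<theta> ^^ m k) (z i j) o\<^sub>L P (m k)" if "i < n" "j < n" for k i j
    by (simp add: w_def embed_op_compression P_def funpow_compose compose_closed range_proj_closed
        zB that)
  have "(\<lambda>k. w k i j (\<xi> j)) \<longlonglongrightarrow> z i j (\<xi> j)" if ij: "i < n" "j < n" for i j
  proof -
    have 1: "(\<lambda>k. (\<theta> ^^ m k) (z i j) (P (m k) (\<xi> j))) \<longlonglongrightarrow> z i j (\<xi> j)"
      by (intro blinfun.tendsto rec[OF ij] Pm)
    have "(\<lambda>k. P (m k) ((\<theta> ^^ m k) (z i j) (P (m k) (\<xi> j)) - z i j (\<xi> j))) \<longlonglongrightarrow> 0"
      by (rule Lim_null_comparison[OF always_eventually tendsto_norm_zero[OF LIM_zero[OF 1]]])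
        (auto intro: projection_norm_le P_projection)
    from tendsto_add[OF this Pm[of "z i j (\<xi> j)"]] show ?thesis
      by (simp add: w[OF ij] blinfun.diff_right)
  qed
  then have "(\<lambda>k. tuple_norm n (mat_apply n (w k) \<xi>)) \<longlonglongrightarrow> tuple_norm n (mat_apply n z \<xi>)"
    unfolding mat_apply_def by (intro tendsto_tuple_norm tendsto_sum) auto
  moreover have "tuple_norm n (mat_apply n (w k) \<xi>) \<le> ?c" for k
  proof -
    have "tuple_norm n (mat_apply n (w k) \<xi>) \<le> matrix_norm n (w k)"
      by (rule tuple_norm_mat_apply_le_matrix_norm1[OF \<xi>])
    also have "\<dots> \<le> matrix_norm n (\<lambda>i j. embed_op V (compression V (z i j)))"
      unfolding w_def by (rule normal_endomorphism.completely_contractive[OF funpow_endomorphism])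
        (intro embed_op_closed compression_closed zB)
    also have "\<dots> \<le> ?c" by (rule matrix_norm_embed_op_le)
    finally show ?thesis .
  qed
  ultimately show "tuple_norm n (mat_apply n z \<xi>) \<le> ?c"
    by (intro LIMSEQ_le_const2) auto
qed

end


section \<open>Extension to the norm closures\<close>

subclass (in complex_hilbert_space) banach ..

text \<open>The image of a sequence in \<open>X\<close> is Cauchy only if the sequence is, which gives surjectivity onto
  \<open>closure Y\<close>; the matrix norms are continuous in the entries, which extends the isometry.\<close>

lemma complete_isometry_closure:
  fixes \<Phi> :: "('a::complex_hilbert_space \<Rightarrow>\<^sub>L 'a) \<Rightarrow> ('b::complex_hilbert_space \<Rightarrow>\<^sub>L 'b)"
  assumes bl: "bounded_linear \<Phi>" and scale: "\<And>c x. \<Phi> (c *\<^sub>C x) = c *\<^sub>C \<Phi> x"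
    and X: "\<And>x y. x \<in> X \<Longrightarrow> y \<in> X \<Longrightarrow> x - y \<in> X" and Y: "\<Phi> ` X = Y"
    and iso: "\<And>n z. (\<And>i j. i < n \<Longrightarrow> j < n \<Longrightarrow> z i j \<in> X) \<Longrightarrow>
      matrix_norm n (\<lambda>i j. \<Phi> (z i j)) = matrix_norm n z"
  shows "complete_isometric_isomorphism \<Phi> (closure X) (closure Y)"
proof -
  interpret \<Phi>: bounded_linear \<Phi> by fact
  have norm_iso: "norm (\<Phi> x) = norm x" if "x \<in> X" for x
    using iso[of 1 "\<lambda>_ _. x"] that unfolding matrix_norm_one by simp
  have dist_X: "dist (\<Phi> x) (\<Phi> y) = dist x y" if "x \<in> X" "y \<in> X" for x y
    using norm_iso[OF X[OF that]] by (simp add: dist_norm \<Phi>.diff)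
  have inj: "inj_on \<Phi> (closure X)"
  proof (rule inj_onI)
    fix x y assume x: "x \<in> closure X" and y: "y \<in> closure X" and eq: "\<Phi> x = \<Phi> y"
    obtain f where f: "\<And>k. f k \<in> X" "f \<longlonglongrightarrow> x" using x unfolding closure_sequential by blast
    obtain g where g: "\<And>k. g k \<in> X" "g \<longlonglongrightarrow> y" using y unfolding closure_sequential by blast
    have "(\<lambda>k. dist (\<Phi> (f k)) (\<Phi> (g k))) \<longlonglongrightarrow> dist (\<Phi> x) (\<Phi> y)"
      by (intro tendsto_dist \<Phi>.tendsto f g)
    moreover have "(\<lambda>k. dist (\<Phi> (f k)) (\<Phi> (g k))) \<longlonglongrightarrow> dist x y"
      unfolding dist_X[OF f(1) g(1)] by (intro tendsto_dist f g)
    ultimately have "dist (\<Phi> x) (\<Phi> y) = dist x y" by (rule LIMSEQ_unique)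
    then show "x = y" using eq by simp
  qed
  have "\<Phi> ` closure X = closure Y"
  proof (intro equalityI subsetI)
    fix w assume "w \<in> \<Phi> ` closure X"
    then obtain x where x: "x \<in> closure X" and w: "w = \<Phi> x" by blast
    obtain f where f: "\<And>k. f k \<in> X" "f \<longlonglongrightarrow> x" using x unfolding closure_sequential by blast
    have "\<forall>k. \<Phi> (f k) \<in> Y" using f(1) Y by blast
    then show "w \<in> closure Y"
      unfolding closure_sequential w using \<Phi>.tendsto[OF f(2)] by (intro exI[of _ "\<lambda>k. \<Phi> (f k)"]) simp
  next
    fix w assume "w \<in> closure Y"
    then obtain g where g: "\<And>k. g k \<in> Y" "g \<longlonglongrightarrow> w" unfolding closure_sequential by blast
    have "\<forall>k. \<exists>x. x \<in> X \<and> g k = \<Phi> x" using g(1) Y by blast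
    then obtain f where f: "\<And>k. f k \<in> X" "\<And>k. g k = \<Phi> (f k)" by metis
    have "Cauchy g" using g(2) by (rule LIMSEQ_imp_Cauchy)
    then have "Cauchy f" unfolding Cauchy_def f(2) dist_X[OF f(1) f(1)] .
    then obtain x where x: "f \<longlonglongrightarrow> x" using Cauchy_convergent convergent_def by blast
    then have "x \<in> closure X" using f(1) unfolding closure_sequential by blast
    moreover have "(\<lambda>k. g k) \<longlonglongrightarrow> \<Phi> x" unfolding f(2) by (rule \<Phi>.tendsto[OF x])
    then have "w = \<Phi> x" by (rule LIMSEQ_unique[OF g(2)])
    ultimately show "w \<in> \<Phi> ` closure X" by blast
  qed
  moreover have "matrix_norm n (\<lambda>i j. \<Phi> (z i j)) = matrix_norm n z"
    if z: "\<forall>i<n. \<forall>j<n. z i j \<in> closure X" for n z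
  proof -
    have "\<exists>f. i < n \<longrightarrow> j < n \<longrightarrow> (\<forall>k. f k \<in> X) \<and> f \<longlonglongrightarrow> z i j" for i j
      using z unfolding closure_sequential by (cases "i < n \<and> j < n") auto
    then obtain f where f: "\<And>i j. i < n \<Longrightarrow> j < n \<Longrightarrow> (\<forall>k. f i j k \<in> X) \<and> f i j \<longlonglongrightarrow> z i j"
      by metis
    have "(\<lambda>k. matrix_norm n (\<lambda>i j. f i j k)) \<longlonglongrightarrow> matrix_norm n z"
      using f by (intro tendsto_matrix_norm) auto
    moreover have "(\<lambda>k. matrix_norm n (\<lambda>i j. \<Phi> (f i j k))) \<longlonglongrightarrow> matrix_norm n (\<lambda>i j. \<Phi> (z i j))"
      using f by (intro tendsto_matrix_norm \<Phi>.tendsto) auto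
    moreover have "matrix_norm n (\<lambda>i j. \<Phi> (f i j k)) = matrix_norm n (\<lambda>i j. f i j k)" for k
      using f by (intro iso) auto
    ultimately show ?thesis using LIMSEQ_unique by simp blast
  qed
  ultimately show ?thesis
    using inj by (auto simp: complete_isometric_isomorphism_def bij_betw_def clinear_map_on_def
        \<Phi>.add scale)
qed

lemma compression_bounded_linear: "bounded_linear (compression V)"
proof -
  have "bounded_linear (\<lambda>z. adj V o\<^sub>L z o\<^sub>L V)"
    by (intro bounded_linear_compose[OF bounded_bilinear.bounded_linear_left[OF bounded_bilinear_blinfun_compose]]
        bounded_bilinear.bounded_linear_right[OF bounded_bilinear_blinfun_compose])
  then show ?thesis by (simp add: compression_def[abs_def])
qed

lemma peripheral_isomorphism:
  fixes V :: "'h::complex_hilbert_space \<Rightarrow>\<^sub>L 'k::complex_hilbert_space"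
  assumes V: "V \<in> clinear_ops"
    and eigen: "\<And>l y. cmod l = 1 \<Longrightarrow> y \<in> peripheral_eigenspace B \<theta> l \<Longrightarrow>
      compression V y \<in> peripheral_eigenspace A \<tau> l"
    and lift: "\<And>l x. cmod l = 1 \<Longrightarrow> x \<in> peripheral_eigenspace A \<tau> l \<Longrightarrow>
      \<exists>y\<in>peripheral_eigenspace B \<theta> l. compression V y = x"
    and iso: "\<And>n z. (\<And>i j. i < n \<Longrightarrow> j < n \<Longrightarrow>
      z i j \<in> cspan (\<Union>l\<in>{l. cmod l = 1}. peripheral_eigenspace B \<theta> l)) \<Longrightarrow>
      matrix_norm n (\<lambda>i j. compression V (z i j)) = matrix_norm n z"
  shows "complete_isometric_isomorphism (compression V) (peripheral_space B \<theta>) (peripheral_space A \<tau>)"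
  unfolding peripheral_space_def
proof (rule complete_isometry_closure[OF compression_bounded_linear _ _ _ iso])
  interpret \<Phi>: bounded_linear "compression V" by (rule compression_bounded_linear)
  let ?E = "\<Union>l\<in>{l. cmod l = 1}. peripheral_eigenspace B \<theta> l"
  show scale: "compression V (c *\<^sub>C x) = c *\<^sub>C compression V x" for c x
    by (rule blinfun_eqI)
      (simp add: compression_def scaleC_blinfun_apply clinear_opsD[OF adj_clinear[OF V]])
  have hom: "module_hom scaleC scaleC (compression V)"
    by (intro module_hom.intro module_hom_axioms.intro complex_vector.module_axioms \<Phi>.add scale)
  have "compression V ` ?E = (\<Union>l\<in>{l. cmod l = 1}. peripheral_eigenspace A \<tau> l)"
    using eigen lift by (auto simp: image_iff) (metis (no_types))
  then show "compression V ` cspan ?E = cspan (\<Union>l\<in>{l. cmod l = 1}. peripheral_eigenspace A \<tau> l)"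
    by (metis module_hom.span_image[OF hom])
qed (auto intro: complex_vector.span_diff)


section \<open>Maps that are not unital\<close>

lemma scaleC_direct_sum: "c *\<^sub>C direct_sum x d = direct_sum (c *\<^sub>C x) (c * d)"
  by (rule blinfun_eqI)
    (simp add: scaleC_blinfun_apply direct_sum.rep_eq scaleC_prod_def scaleC_complex_def)

lemma direct_sum_add: "direct_sum x c + direct_sum y d = direct_sum (x + y) (c + d)"
  by (rule blinfun_eqI) (simp add: blinfun.add_left direct_sum.rep_eq distrib_right)

lemma direct_sum_zero: "direct_sum 0 0 = 0"
  by (rule blinfun_eqI) (simp add: direct_sum.rep_eq prod_eq_iff)

lemma direct_sum_id: "direct_sum id_blinfun 1 = id_blinfun"
  by (rule blinfun_eqI) (simp add: direct_sum.rep_eq)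

lemma adj_direct_sum: "V \<in> clinear_ops \<Longrightarrow> adj (direct_sum V 1) = direct_sum (adj V) 1"
  by (rule adj_eqI) (simp add: cinner_prod_def direct_sum.rep_eq cinner_adj_left)

lemma clinear_direct_sum:
  assumes "direct_sum V 1 \<in> clinear_ops"
  shows "V \<in> clinear_ops"
  unfolding clinear_ops_def
proof (intro CollectI allI)
  fix c x
  show "blinfun_apply V (c *\<^sub>C x) = c *\<^sub>C blinfun_apply V x"
    using clinear_opsD[OF assms, of c "(x, 0)"] by (simp add: direct_sum.rep_eq scaleC_prod_def)
qed

lemma compression_direct_sum:
  "V \<in> clinear_ops \<Longrightarrow> compression (direct_sum V 1) (direct_sum z c) = direct_sum (compression V z) c"
  by (rule blinfun_eqI) (simp add: compression_def adj_direct_sum direct_sum.rep_eq)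

text \<open>On operators with scalar part \<open>0\<close> the correction term \<open>c (1 - \<sigma>(1))\<close> of the unitization
  vanishes.\<close>

lemma direct_sum_eigen_iff:
  "direct_sum x 0 \<in> peripheral_eigenspace (unitize_algebra M) (unitize_map \<sigma>) l \<longleftrightarrow>
    x \<in> peripheral_eigenspace M \<sigma> l"
  by (auto simp: peripheral_eigenspace_def unitize_algebra_def unitize_map_direct_sum
      scaleC_direct_sum direct_sum_eq_iff)

lemma matrix_norm_direct_sum: "matrix_norm n (\<lambda>i j. direct_sum (z i j) 0) = matrix_norm n z"
proof (rule antisym; rule matrix_norm_leI)
  let ?s = "\<lambda>i j. direct_sum (z i j) 0"
  have app: "mat_apply n ?s x i = (mat_apply n z (\<lambda>j. fst (x j)) i, 0)" for x i
    by (simp add: mat_apply_def direct_sum.rep_eq prod_eq_iff fst_sum snd_sum)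
  show "tuple_norm n (mat_apply n ?s x) \<le> matrix_norm n z" if x: "tuple_norm n x \<le> 1" for x
  proof -
    have "tuple_norm n (\<lambda>j. fst (x j)) \<le> tuple_norm n x"
      by (intro tuple_norm_mono) (metis norm_fst_le prod.collapse)
    then have "tuple_norm n (mat_apply n z (\<lambda>j. fst (x j))) \<le> matrix_norm n z"
      using x by (intro tuple_norm_mat_apply_le_matrix_norm1) simp
    then show ?thesis by (simp add: tuple_norm_def app)
  qed
  show "tuple_norm n (mat_apply n z x) \<le> matrix_norm n ?s" if x: "tuple_norm n x \<le> 1" for x
    using tuple_norm_mat_apply_le_matrix_norm1[of n "\<lambda>j. (x j, 0)" ?s] x
    by (simp add: tuple_norm_def app)
qed

lemma direct_sum_eigen_span:
  assumes "z \<in> cspan (\<Union>l\<in>U. peripheral_eigenspace M \<sigma> l)"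
  shows "direct_sum z 0 \<in> cspan (\<Union>l\<in>U. peripheral_eigenspace (unitize_algebra M) (unitize_map \<sigma>) l)"
  using assms
proof (induction rule: complex_vector.span_induct_alt)
  case base
  show ?case by (simp add: direct_sum_zero complex_vector.span_zero)
next
  case (step c x y)
  have "direct_sum x 0 \<in> (\<Union>l\<in>U. peripheral_eigenspace (unitize_algebra M) (unitize_map \<sigma>) l)"
    using step.hyps by (simp add: direct_sum_eigen_iff)
  moreover have "direct_sum (c *\<^sub>C x + y) 0 = c *\<^sub>C direct_sum x 0 + direct_sum y 0"
    by (simp add: scaleC_direct_sum direct_sum_add)
  ultimately show ?case using step.IH
    by (simp add: complex_vector.span_add complex_vector.span_scale complex_vector.span_base)
qed

theorem theorem3p3:
  fixes V :: "'h::complex_hilbert_space \<Rightarrow>\<^sub>L 'k::complex_hilbert_space"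
    and A :: "('h \<Rightarrow>\<^sub>L 'h) set" and \<tau> :: "('h \<Rightarrow>\<^sub>L 'h) \<Rightarrow> ('h \<Rightarrow>\<^sub>L 'h)"
    and B :: "('k \<Rightarrow>\<^sub>L 'k) set" and \<theta> :: "('k \<Rightarrow>\<^sub>L 'k) \<Rightarrow> ('k \<Rightarrow>\<^sub>L 'k)"
  assumes "separable_space (euclidean :: 'h topology)"
    and "von_neumann_algebra A"
    and "normal_contractive_cp_map A \<tau>"
    and "minimal_dilation V A \<tau> B \<theta>"
  shows "complete_isometric_isomorphism (compression V) (peripheral_space B \<theta>) (peripheral_space A \<tau>)"
proof (cases "\<tau> id_blinfun = id_blinfun")
  case True
  then interpret unital_dilation V A \<tau> B \<theta>
    using assms(4) by unfold_locales (simp_all add: minimal_dilation_def)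
  show ?thesis
    by (rule peripheral_isomorphism[OF V_clinear compression_eigen _ matrix_norm_compression])
      (blast elim: eigen_lift)+
next
  case False
  then interpret unital_dilation "direct_sum V 1" "unitize_algebra A" "unitize_map \<tau>"
    "unitize_algebra B" "unitize_map \<theta>"
  proof unfold_locales
    show "unitize_map \<tau> id_blinfun = id_blinfun"
      using unitize_map_direct_sum[of \<tau> id_blinfun 1] by (simp add: direct_sum_id)
  qed (use assms(4) in \<open>simp add: minimal_dilation_def\<close>)
  have V: "V \<in> clinear_ops" by (rule clinear_direct_sum[OF V_clinear])
  show ?thesis
  proof (rule peripheral_isomorphism[OF V])
    fix l y assume "y \<in> peripheral_eigenspace B \<theta> l"
    then show "compression V y \<in> peripheral_eigenspace A \<tau> l"
      using compression_eigen[of "direct_sum y 0" l]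
      by (simp add: direct_sum_eigen_iff compression_direct_sum[OF V])
  next
    fix l x assume l: "cmod l = 1" and "x \<in> peripheral_eigenspace A \<tau> l"
    then have "direct_sum x 0 \<in> peripheral_eigenspace (unitize_algebra A) (unitize_map \<tau>) l"
      by (simp add: direct_sum_eigen_iff)
    then obtain w where w: "w \<in> peripheral_eigenspace (unitize_algebra B) (unitize_map \<theta>) l"
      "compression (direct_sum V 1) w = direct_sum x 0" using l by (rule eigen_lift)
    obtain y c where y: "w = direct_sum y c"
      using w(1) by (auto simp: peripheral_eigenspace_def unitize_algebra_def)
    with w(2) have "compression V y = x" "c = 0"
      by (simp_all add: compression_direct_sum[OF V] direct_sum_eq_iff)
    then show "\<exists>y\<in>peripheral_eigenspace B \<theta> l. compression V y = x"
      using w(1) y direct_sum_eigen_iff by blast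
  next
    fix n :: nat and z :: "nat \<Rightarrow> nat \<Rightarrow> 'k \<Rightarrow>\<^sub>L 'k"
    assume "\<And>i j. i < n \<Longrightarrow> j < n \<Longrightarrow>
      z i j \<in> cspan (\<Union>l\<in>{l. cmod l = 1}. peripheral_eigenspace B \<theta> l)"
    then have "matrix_norm n (\<lambda>i j. compression (direct_sum V 1) (direct_sum (z i j) 0))
        = matrix_norm n (\<lambda>i j. direct_sum (z i j) 0)"
      by (intro matrix_norm_compression direct_sum_eigen_span)
    then show "matrix_norm n (\<lambda>i j. compression V (z i j)) = matrix_norm n z"
      by (simp add: compression_direct_sum[OF V] matrix_norm_direct_sum)
  qed
qed

end
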